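(* Let $X$ be a metric space, let $\mu$ be a measure over $X$, let $\alpha>0$ and fix $A\subset X$. Assume: (1) $X$ is a diametrically regular metric space. (2) $\mu$ is a Borel regular measure. (3) $(\mathcal F_b)_{\mu,\zeta_{b,\alpha}}$ covers $A$ finely. (4) $A$ is $\mathcal S^\alpha$-measurable and $\sigma$-finite with respect to $\mathcal S^\alpha$. (5) $A$ has a countable covering whose elements are open and have finite $\mu$-measure. (6) $\mu\llcorner A\ll\mathcal S^\alpha\llcorner A$. Then $\mathfrak s^\alpha(\mu,\cdot):A\to[0,+\infty]$ is $\mathcal S^\alpha$-measurable, every $\mathcal S^\alpha$-measurable set $B\subset A$ is also $\mu$-measurable, and for every such $B$ we have $$\mu(B)=\int_B\mathfrak s^\alpha(\mu,x)\,d\mathcal S^\alpha(x).$$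
   Context: A "measure over $X$" is an outer measure defined on all subsets of $X$; measurability is in the sense of Carathéodory, and integrals are with respect to the restriction of the outer measure to its measurable sets. A measure $\mu$ over $X$ is Borel regular if all Borel sets are $\mu$-measurable and every $E\subset X$ is contained in a Borel set $E'$ with $\mu(E')=\mu(E)$. A set is $\sigma$-finite with respect to a measure over $X$ if it is covered by countably many sets of finite measure. $(\mu\llcorner A)(E)=\mu(A\cap E)$, and $\mu\llcorner A\ll\psi\llcorner A$ means that $\mu(N)=0$ for every $N\subset A$ with $\psi(N)=0$. For $x\in X$, $r>0$, $B(x,r)=\{y\in X:d(x,y)<r\}$ and $\mathbb B(x,r)=\{y\in X:d(x,y)\le r\}$ are the open and closed balls. $X$ is diametrically regular if for every $x\in X$ there exist $R_x>0$ and $\delta_x>0$ such that for every $y\in B(x,R_x)$ the function $(0,\delta_x)\ni r\mapsto\operatorname{diam}(B(y,r))$ is continuous. $\mathcal F_b$ is the family of all closed balls $\mathbb B(x,r)$ in $X$ ($x\in X$, $r>0$), $c_\alpha>0$ is a fixed constant, and $\zeta_{b,\alpha}:\mathcal F_b\to[0,+\infty)$ is $\zeta_{b,\alpha}(S)=c_\alpha\operatorname{diam}(S)^\alpha$. The $\alpha$-dimensional spherical measure is $\mathcal S^\alpha(R)=\sup_{\delta>0}\inf\sum_j\zeta_{b,\alpha}(E_j)$, the infimum being over all countable (possibly finite) families $\{E_j\}\subset\mathcal F_b$ covering $R$ with $\operatorname{diam}(E_j)\le\delta$ for all $j$ ($\inf\emptyset=+\infty$). $(\mathcal F_b)_{\mu,\zeta_{b,\alpha}}=\mathcal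 F_b\setminus\{S\in\mathcal F_b:\ \zeta_{b,\alpha}(S)=\mu(S)=0\ \text{or}\ \mu(S)=\zeta_{b,\alpha}(S)=+\infty\}$. A family $\mathcal G\subset\mathcal P(X)$ covers $A$ finely if for every $a\in A$ and $\epsilon>0$ there is $S\in\mathcal G$ with $a\in S$ and $\operatorname{diam}(S)<\epsilon$. The quotient function $Q:(\mathcal F_b)_{\mu,\zeta_{b,\alpha}}\to[0,+\infty]$ is $Q(S)=+\infty$ if $\zeta_{b,\alpha}(S)=0$ and $Q(S)=\mu(S)/\zeta_{b,\alpha}(S)$ if $\zeta_{b,\alpha}(S)>0$. For $x\in A$ the Federer density is $$\mathfrak s^\alpha(\mu,x)=\inf_{\epsilon>0}\sup\{Q(S): S\in(\mathcal F_b)_{\mu,\zeta_{b,\alpha}},\ x\in S,\ \operatorname{diam}(S)<\epsilon\}.$$ *)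

theory Defs
  imports "HOL-Analysis.Analysis"
begin

text \<open>
  The metric space \<open>X\<close> is the universe of a type of class \<^class>\<open>metric_space\<close>.
  The library's \<^const>\<open>countably_subadditive\<close> only speaks about disjoint sequences; for an
  increasing set function on all subsets this is the usual countable subadditivity.
\<close>

definition measure_over :: "('a set \<Rightarrow> ennreal) \<Rightarrow> bool" where
  "measure_over \<mu> \<longleftrightarrow> outer_measure_space (Pow UNIV) \<mu>"

abbreviation caratheodory_sets :: "('a set \<Rightarrow> ennreal) \<Rightarrow> 'a set set" where
  "caratheodory_sets \<mu> \<equiv> lambda_system UNIV (Pow UNIV) \<mu>"

definition caratheodory_restriction :: "('a set \<Rightarrow> ennreal) \<Rightarrow> 'a measure" where
  "caratheodory_restriction \<mu> = measure_of UNIV (caratheodory_sets \<mu>) \<mu>"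

lemma space_caratheodory_restriction: "space (caratheodory_restriction \<mu>) = UNIV"
  by (simp add: caratheodory_restriction_def)

lemma
  assumes "measure_over \<mu>"
  shows sets_caratheodory_restriction:
      "sets (caratheodory_restriction \<mu>) = caratheodory_sets \<mu>"
    and emeasure_caratheodory_restriction:
      "E \<in> caratheodory_sets \<mu> \<Longrightarrow> emeasure (caratheodory_restriction \<mu>) E = \<mu> E"
proof -
  interpret sigma_algebra UNIV "Pow UNIV :: 'a set set"
    by (rule sigma_algebra_Pow)
  have ms: "measure_space UNIV (caratheodory_sets \<mu>) \<mu>"
    using assms unfolding measure_over_def by (rule caratheodory_lemma)
  then have sa: "sigma_algebra UNIV (caratheodory_sets \<mu>)"
    by (simp add: measure_space_def)
  show "sets (caratheodory_restriction \<mu>) = caratheodory_sets \<mu>"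
    unfolding caratheodory_restriction_def by (rule sigma_algebra.sets_measure_of_eq[OF sa])
  show "emeasure (caratheodory_restriction \<mu>) E = \<mu> E" if "E \<in> caratheodory_sets \<mu>"
    using ms that sa unfolding caratheodory_restriction_def
    by (intro emeasure_measure_of_sigma) (auto simp: measure_space_def)
qed

definition borel_regular :: "('a::metric_space set \<Rightarrow> ennreal) \<Rightarrow> bool" where
  "borel_regular \<mu> \<longleftrightarrow>
     sets borel \<subseteq> caratheodory_sets \<mu> \<and>
     (\<forall>E. \<exists>E'\<in>sets borel. E \<subseteq> E' \<and> \<mu> E' = \<mu> E)"

definition sigma_finite_wrt :: "('a set \<Rightarrow> ennreal) \<Rightarrow> 'a set \<Rightarrow> bool" where
  "sigma_finite_wrt \<mu> A \<longleftrightarrow> (\<exists>\<C>. countable \<C> \<and> A \<subseteq> \<Union>\<C> \<and> (\<forall>E\<in>\<C>. \<mu> E < \<infinity>))"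

definition abs_continuous_on :: "'a set \<Rightarrow> ('a set \<Rightarrow> ennreal) \<Rightarrow> ('a set \<Rightarrow> ennreal) \<Rightarrow> bool" where
  "abs_continuous_on A \<mu> \<psi> \<longleftrightarrow> (\<forall>N. N \<subseteq> A \<longrightarrow> \<psi> N = 0 \<longrightarrow> \<mu> N = 0)"

definition diametrically_regular :: "'a::metric_space itself \<Rightarrow> bool" where
  "diametrically_regular _ \<longleftrightarrow>
     (\<forall>x::'a. \<exists>R>0. \<exists>\<delta>>0. \<forall>y\<in>ball x R. continuous_on {0<..<\<delta>} (\<lambda>r. diameter (ball y r)))"

definition closed_balls :: "'a::metric_space set set" where
  "closed_balls = {cball x r | x r. r > 0}"

text \<open>
  Since \<^const>\<open>powr\<close> satisfies \<open>0 powr \<alpha> = 0\<close>, a ball of diameter zero gets the value zero.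
  Balls are bounded, so the real-valued \<^const>\<open>diameter\<close> is the true diameter.
\<close>

definition zeta_b :: "real \<Rightarrow> real \<Rightarrow> 'a::metric_space set \<Rightarrow> ennreal" where
  "zeta_b c \<alpha> S = ennreal (c * diameter S powr \<alpha>)"

text \<open>
  A countable, possibly finite or empty, family is given by \<open>E j\<close> for \<open>j\<close> in an arbitrary
  index set \<open>J\<close> of natural numbers.
\<close>

definition spherical_pre :: "real \<Rightarrow> real \<Rightarrow> real \<Rightarrow> 'a::metric_space set \<Rightarrow> ennreal" where
  "spherical_pre c \<alpha> \<delta> R =
     Inf {(\<Sum>j. if j \<in> J then zeta_b c \<alpha> (E j) else 0) | (J :: nat set) E.
            (\<forall>j\<in>J. E j \<in> closed_balls \<and> diameter (E j) \<le> \<delta>) \<and> R \<subseteq> (\<Union>j\<in>J. E j)}"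

definition spherical_measure :: "real \<Rightarrow> real \<Rightarrow> 'a::metric_space set \<Rightarrow> ennreal" where
  "spherical_measure c \<alpha> R = (SUP \<delta>\<in>{0<..}. spherical_pre c \<alpha> \<delta> R)"

lemma spherical_pre_le:
  assumes "\<And>j. j \<in> J \<Longrightarrow> E j \<in> closed_balls \<and> diameter (E j) \<le> \<delta>" and "R \<subseteq> (\<Union>j\<in>J. E j)"
  shows "spherical_pre c \<alpha> \<delta> R \<le> (\<Sum>j. if j \<in> J then zeta_b c \<alpha> (E j) else 0)"
  unfolding spherical_pre_def using assms by (intro Inf_lower) blast

lemma spherical_pre_empty: "spherical_pre c \<alpha> \<delta> {} = 0"
  using spherical_pre_le[of "{}" _ \<delta> "{}" c \<alpha>] by simp

lemma spherical_pre_mono: "R \<subseteq> R' \<Longrightarrow> spherical_pre c \<alpha> \<delta> R \<le> spherical_pre c \<alpha> \<delta> R'"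
  unfolding spherical_pre_def by (intro Inf_superset_mono) blast

lemma spherical_pre_subadditive:
  "spherical_pre c \<alpha> \<delta> (\<Union>i::nat. R i) \<le> (\<Sum>i. spherical_pre c \<alpha> \<delta> (R i))"
proof (rule ennreal_le_epsilon)
  let ?p = "spherical_pre c \<alpha> \<delta>"
  fix e :: real
  assume e: "0 < e" and fin: "(\<Sum>i. ?p (R i)) < top"
  have "\<exists>J E. (\<forall>j\<in>J. E j \<in> closed_balls \<and> diameter (E j) \<le> \<delta>) \<and> R i \<subseteq> (\<Union>j\<in>J. E j) \<and>
      (\<Sum>j. if j \<in> J then zeta_b c \<alpha> (E j) else 0) \<le> ?p (R i) + e * (1 / 2) ^ Suc i" for i
  proof -
    have "?p (R i) < top"
      using fin ennreal_suminf_lessD by blast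
    then have "?p (R i) < ?p (R i) + e * (1 / 2) ^ Suc i"
      using e by (auto simp: less_top)
    then obtain v where v: "v < ?p (R i) + e * (1 / 2) ^ Suc i"
      "\<exists>J E. v = (\<Sum>j. if j \<in> J then zeta_b c \<alpha> (E j) else 0) \<and>
         (\<forall>j\<in>J. E j \<in> closed_balls \<and> diameter (E j) \<le> \<delta>) \<and> R i \<subseteq> (\<Union>j\<in>J. E j)"
      unfolding spherical_pre_def Inf_less_iff mem_Collect_eq by blast
    then show ?thesis
      by (meson less_imp_le)
  qed
  then have "\<forall>i. \<exists>J E. (\<forall>j\<in>J. E j \<in> closed_balls \<and> diameter (E j) \<le> \<delta>) \<and>
      R i \<subseteq> (\<Union>j\<in>J. E j) \<and>
      (\<Sum>j. if j \<in> J then zeta_b c \<alpha> (E j) else 0) \<le> ?p (R i) + e * (1 / 2) ^ Suc i"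
    by (intro allI)
  from this[unfolded choice_iff] obtain J E where
      JE: "\<forall>i. (\<forall>j\<in>J i. E i j \<in> closed_balls \<and> diameter (E i j) \<le> \<delta>) \<and>
        R i \<subseteq> (\<Union>j\<in>J i. E i j) \<and>
        (\<Sum>j. if j \<in> J i then zeta_b c \<alpha> (E i j) else 0) \<le> ?p (R i) + e * (1 / 2) ^ Suc i"
    by (elim exE)
  then have cov: "\<And>i. R i \<subseteq> (\<Union>j\<in>J i. E i j)"
    and le: "\<And>i. (\<Sum>j. if j \<in> J i then zeta_b c \<alpha> (E i j) else 0)
               \<le> ?p (R i) + e * (1 / 2) ^ Suc i"
    by simp_all
  define K where "K = {n. snd (prod_decode n) \<in> J (fst (prod_decode n))}"
  define F where "F = (\<lambda>n. case prod_decode n of (i, j) \<Rightarrow> E i j)"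
  let ?g = "\<lambda>(i, j). if j \<in> J i then zeta_b c \<alpha> (E i j) else 0"
  have "?p (\<Union>i. R i) \<le> (\<Sum>n. if n \<in> K then zeta_b c \<alpha> (F n) else 0)"
  proof (rule spherical_pre_le)
    show "F n \<in> closed_balls \<and> diameter (F n) \<le> \<delta>" if "n \<in> K" for n
      using that JE by (auto simp: K_def F_def split: prod.splits)
    show "(\<Union>i. R i) \<subseteq> (\<Union>n\<in>K. F n)"
    proof
      fix x assume "x \<in> (\<Union>i. R i)"
      then obtain i j where "j \<in> J i" "x \<in> E i j"
        using cov by blast
      then have "prod_encode (i, j) \<in> K" "x \<in> F (prod_encode (i, j))"
        by (auto simp: K_def F_def)
      then show "x \<in> (\<Union>n\<in>K. F n)" by blast
    qed
  qed
  also have "\<dots> = (\<Sum>n. ?g (prod_decode n))"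
    by (intro arg_cong[where f = suminf] ext) (auto simp: K_def F_def split: prod.splits)
  also have "\<dots> = (\<Sum>i. \<Sum>j. ?g (i, j))"
    by (rule suminf_ennreal_2dimen) simp
  also have "\<dots> \<le> (\<Sum>i. ?p (R i) + e * (1 / 2) ^ Suc i)"
    using le by (intro suminf_le) auto
  also have "\<dots> = (\<Sum>i. ?p (R i)) + (\<Sum>i. ennreal e * ennreal ((1 / 2) ^ Suc i))"
    using e by (subst suminf_add[symmetric])
      (auto simp del: ennreal_suminf_cmult simp add: ennreal_mult[symmetric])
  also have "(\<Sum>i. ennreal e * ennreal ((1 / 2) ^ Suc i)) = e"
    unfolding ennreal_suminf_cmult
    by (subst suminf_ennreal_eq[OF zero_le_power power_half_series]) auto
  finally show "?p (\<Union>i. R i) \<le> (\<Sum>i. ?p (R i)) + ennreal e" .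
qed

lemma measure_over_spherical_measure:
  "measure_over (spherical_measure c \<alpha> :: 'a::metric_space set \<Rightarrow> ennreal)" (is "measure_over ?S")
  unfolding measure_over_def outer_measure_space_def
proof (intro conjI)
  show "positive (Pow UNIV) ?S"
    by (simp add: positive_def spherical_measure_def spherical_pre_empty)
  show "increasing (Pow UNIV) ?S"
    unfolding increasing_def spherical_measure_def
    by (auto intro!: SUP_mono' spherical_pre_mono)
  show "countably_subadditive (Pow UNIV) ?S"
    unfolding countably_subadditive_def
  proof (intro allI impI)
    fix R :: "nat \<Rightarrow> 'a set"
    show "spherical_measure c \<alpha> (\<Union>i. R i) \<le> (\<Sum>i. spherical_measure c \<alpha> (R i))"
      unfolding spherical_measure_def[of c \<alpha> "\<Union>i. R i"]
    proof (rule SUP_least)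
      fix \<delta> :: real assume "\<delta> \<in> {0<..}"
      then show "spherical_pre c \<alpha> \<delta> (\<Union>i. R i) \<le> (\<Sum>i. spherical_measure c \<alpha> (R i))"
        unfolding spherical_measure_def
        by (intro order_trans[OF spherical_pre_subadditive] suminf_le SUP_upper) auto
    qed
  qed
qed

definition nondegenerate_family ::
    "'a set set \<Rightarrow> ('a set \<Rightarrow> ennreal) \<Rightarrow> ('a set \<Rightarrow> ennreal) \<Rightarrow> 'a set set" where
  "nondegenerate_family \<F> \<mu> \<zeta> =
     \<F> - {S \<in> \<F>. (\<zeta> S = 0 \<and> \<mu> S = 0) \<or> (\<mu> S = \<infinity> \<and> \<zeta> S = \<infinity>)}"

text \<open>
  The library's \<^const>\<open>diameter\<close> is only meaningful on bounded sets; an unbounded set has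
  infinite diameter and hence never diameter smaller than \<open>\<epsilon>\<close>.
\<close>

definition covers_finely :: "'a::metric_space set set \<Rightarrow> 'a set \<Rightarrow> bool" where
  "covers_finely \<G> A \<longleftrightarrow>
     (\<forall>a\<in>A. \<forall>\<epsilon>>0. \<exists>S\<in>\<G>. a \<in> S \<and> bounded S \<and> diameter S < \<epsilon>)"

definition quotient_fun :: "('a set \<Rightarrow> ennreal) \<Rightarrow> ('a set \<Rightarrow> ennreal) \<Rightarrow> 'a set \<Rightarrow> ennreal" where
  "quotient_fun \<mu> \<zeta> S = (if \<zeta> S = 0 then \<infinity> else \<mu> S / \<zeta> S)"

definition federer_density ::
    "real \<Rightarrow> real \<Rightarrow> ('a::metric_space set \<Rightarrow> ennreal) \<Rightarrow> 'a \<Rightarrow> ennreal" where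
  "federer_density c \<alpha> \<mu> x =
     (INF \<epsilon>\<in>{0<..}. SUP S\<in>{S \<in> nondegenerate_family closed_balls \<mu> (zeta_b c \<alpha>).
                              x \<in> S \<and> diameter S < \<epsilon>}.
        quotient_fun \<mu> (zeta_b c \<alpha>) S)"

end

theory Submission
  imports Defs
begin

text \<open>
  Write \<open>\<psi>\<close> for the spherical measure and \<open>s\<close> for the Federer density. If \<open>s < t\<close> on \<open>E\<close>, economical
  coverings of \<open>E\<close> by small balls give \<open>\<mu> E \<le> t * \<psi> E\<close>. If \<open>s > t\<close> on \<open>E\<close>, a Vitali covering of \<open>E\<close>
  by disjoint balls inside an open set \<open>V\<close> gives \<open>t * \<psi> E \<le> \<mu> V\<close>, and outer regularity of \<open>\<mu>\<close> turns
  this into \<open>t * \<psi> E \<le> \<mu> E\<close>. On a set of finite measure the two bounds, applied to the slices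
  \<open>k * \<epsilon> \<le> s < (k + 1) * \<epsilon>\<close>, identify \<open>\<mu>\<close> with the indefinite integral of \<open>s\<close>. Diametric regularity
  makes \<open>s\<close> Borel, and Borel regularity of \<open>\<psi>\<close> together with absolute
  continuity transfers measurability from \<open>\<psi>\<close> to \<open>\<mu>\<close>.
\<close>

section \<open>Outer measures and Caratheodory's criterion\<close>

text \<open>An exact integral formula requires both comparisons to carry the same constant
  \<open>t\<close>. This is possible because the density takes its supremum over all small closed
  balls containing the point, centred there or not, and the spherical measure is built from the same
  balls. In the upper comparison the scale at which balls become small enough varies with the point;
  the sets on which one scale works increase but need not be measurable, so continuity from below is
  proved for arbitrary sets. The space is not assumed separable: a disjoint family of balls is
  countable because its members have positive measure inside a set of finite measure, and the Borel
  property of the density rests on interiors. Points of infinite density lie in no slice: the lower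
  comparison at arbitrarily high levels makes them \<psi>-null, and absolute continuity then makes
  them \<mu>-null. Finally, \<mu> and \<psi> have different Caratheodory sigma-algebras, so the
  \<psi>-measurable slices must be known to be \<mu>-measurable before \<mu> can be summed over
  them.\<close>

lemma measure_over_empty: "measure_over \<mu> \<Longrightarrow> \<mu> {} = 0"
  by (simp add: measure_over_def outer_measure_space_def positive_def)

lemma measure_over_mono: "measure_over \<mu> \<Longrightarrow> E \<subseteq> F \<Longrightarrow> \<mu> E \<le> \<mu> F"
  by (simp add: measure_over_def outer_measure_space_def increasing_def)

lemma measure_over_UN:
  assumes "measure_over \<mu>"
  shows "\<mu> (\<Union>i::nat. E i) \<le> (\<Sum>i. \<mu> (E i))"
proof -
  have "\<mu> (\<Union>i. E i) = \<mu> (\<Union>i. disjointed E i)"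
    by (simp add: UN_disjointed_eq)
  also have "\<dots> \<le> (\<Sum>i. \<mu> (disjointed E i))"
    using assms disjoint_family_disjointed[of E]
    by (simp add: measure_over_def outer_measure_space_def countably_subadditive_def)
  also have "\<dots> \<le> (\<Sum>i. \<mu> (E i))"
    by (intro suminf_le measure_over_mono[OF assms] disjointed_subset) auto
  finally show ?thesis .
qed

lemma measure_over_Un:
  assumes "measure_over \<mu>"
  shows "\<mu> (E \<union> F) \<le> \<mu> E + \<mu> F"
proof -
  let ?B = "\<lambda>i::nat. if i = 0 then E else if i = 1 then F else {}"
  have "\<mu> (\<Union>i. ?B i) \<le> (\<Sum>i. \<mu> (?B i))"
    by (rule measure_over_UN[OF assms])
  also have "(\<Union>i. ?B i) = E \<union> F"
    by (auto split: if_splits)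
  also have "(\<Sum>i. \<mu> (?B i)) = (\<Sum>i\<in>{0,1}. \<mu> (?B i))"
    by (rule suminf_finite) (auto simp: measure_over_empty[OF assms])
  finally show ?thesis
    by simp
qed

lemma caratheodory_sets_iff:
  "E \<in> caratheodory_sets \<mu> \<longleftrightarrow> (\<forall>x. \<mu> (x \<inter> E) + \<mu> (x - E) = \<mu> x)"
proof -
  interpret sigma_algebra UNIV "Pow UNIV :: 'a set set"
    by (rule sigma_algebra_Pow)
  show ?thesis
    using lambda_system_eq[of \<mu>] by auto
qed

lemma caratheodory_setsI:
  assumes "measure_over \<mu>" and "\<And>x. \<mu> x < \<infinity> \<Longrightarrow> \<mu> (x \<inter> E) + \<mu> (x - E) \<le> \<mu> x"
  shows "E \<in> caratheodory_sets \<mu>"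
  unfolding caratheodory_sets_iff
proof (intro allI antisym)
  fix x
  show "\<mu> (x \<inter> E) + \<mu> (x - E) \<le> \<mu> x"
    using assms(2)[of x] by (cases "\<mu> x = \<infinity>") (auto simp: top.not_eq_extremum)
  have "(x \<inter> E) \<union> (x - E) = x"
    by blast
  then show "\<mu> x \<le> \<mu> (x \<inter> E) + \<mu> (x - E)"
    using measure_over_Un[OF assms(1), of "x \<inter> E" "x - E"] by simp
qed

lemma null_caratheodory_sets:
  assumes "measure_over \<mu>" and "\<mu> N = 0"
  shows "N \<in> caratheodory_sets \<mu>"
proof (rule caratheodory_setsI[OF assms(1)])
  fix x
  have "\<mu> (x \<inter> N) \<le> 0"
    using measure_over_mono[OF assms(1), of "x \<inter> N" N] assms(2) by simp
  then show "\<mu> (x \<inter> N) + \<mu> (x - N) \<le> \<mu> x"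
    using measure_over_mono[OF assms(1), of "x - N" x] by simp
qed

text \<open>Borel hulls \<open>H n\<close> of the sets \<open>E n\<close> need not increase. The
  intersection \<open>K n\<close> of all later hulls does increase, is Borel and lies between
  \<open>E n\<close> and \<open>H n\<close>, so continuity from below for \<open>K\<close> suffices
  although no \<open>E n\<close> is assumed measurable.\<close>

lemma borel_regular_SUP:
  fixes \<mu> :: "'a::metric_space set \<Rightarrow> ennreal"
  assumes m: "measure_over \<mu>" and b: "borel_regular \<mu>" and inc: "incseq E"
  shows "\<mu> (\<Union>n. E n) = (SUP n. \<mu> (E n))"
proof (rule antisym)
  let ?N = "caratheodory_restriction \<mu>"
  have "\<forall>n. \<exists>H. H \<in> sets borel \<and> E n \<subseteq> H \<and> \<mu> H = \<mu> (E n)"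
    using b unfolding borel_regular_def by blast
  then obtain H where H: "\<And>n. H n \<in> sets borel" "\<And>n. E n \<subseteq> H n" "\<And>n. \<mu> (H n) = \<mu> (E n)"
    by metis
  define K where "K n = (\<Inter>m\<in>{n..}. H m)" for n
  have "K n \<in> sets borel" for n
    unfolding K_def using H(1) by (intro sets.countable_INT') auto
  then have K: "K n \<in> sets ?N" for n
    using b unfolding sets_caratheodory_restriction[OF m] borel_regular_def by blast
  have incK: "incseq K"
    by (fastforce simp: incseq_def K_def)
  have "E n \<subseteq> K n" for n
    unfolding K_def using H(2) incseqD[OF inc, of n] by blast
  then have "\<mu> (\<Union>n. E n) \<le> \<mu> (\<Union>n. K n)"
    by (intro measure_over_mono[OF m]) blast
  also have "\<dots> = emeasure ?N (\<Union>n. K n)"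
  proof -
    have "(\<Union>n. K n) \<in> sets ?N"
      using K by blast
    then show ?thesis
      unfolding sets_caratheodory_restriction[OF m]
      by (rule emeasure_caratheodory_restriction[OF m, symmetric])
  qed
  also have "\<dots> = (SUP n. emeasure ?N (K n))"
    using K incK by (intro SUP_emeasure_incseq[symmetric]) auto
  also have "\<dots> \<le> (SUP n. \<mu> (E n))"
  proof (rule SUP_mono')
    fix n
    have "emeasure ?N (K n) = \<mu> (K n)"
      using K by (simp add: emeasure_caratheodory_restriction[OF m] sets_caratheodory_restriction[OF m])
    also have "\<dots> \<le> \<mu> (H n)"
      by (intro measure_over_mono[OF m]) (auto simp: K_def)
    finally show "emeasure ?N (K n) \<le> \<mu> (E n)"
      by (simp add: H(3))
  qed
  finally show "\<mu> (\<Union>n. E n) \<le> (SUP n. \<mu> (E n))" .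
  show "(SUP n. \<mu> (E n)) \<le> \<mu> (\<Union>n. E n)"
    by (intro SUP_least measure_over_mono[OF m]) blast
qed

lemma ennreal_suminf_tail:
  fixes f :: "nat \<Rightarrow> ennreal"
  assumes "(\<Sum>k. f k) \<noteq> \<infinity>"
  shows "(\<lambda>n. \<Sum>k. f (k + n)) \<longlonglongrightarrow> 0"
proof -
  have eq: "(\<Sum>k. f (k + n)) = (\<Sum>k. f k) - (\<Sum>k<n. f k)" for n
  proof -
    have "(\<Sum>k<n. f k) \<le> (\<Sum>k. f k)"
      by (rule sum_le_suminf) auto
    then have "(\<Sum>k<n. f k) \<noteq> top"
      using assms by (metis infinity_ennreal_def top_unique)
    then show ?thesis
      using suminf_offset[of f n] by (simp add: ennreal_add_diff_cancel_right)
  qed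
  have "(\<lambda>n. (\<Sum>k. f k) - (\<Sum>k<n. f k)) \<longlonglongrightarrow> (\<Sum>k. f k) - (\<Sum>k. f k)"
    using assms by (intro tendsto_diff_ennreal summable_LIMSEQ tendsto_const) auto
  then show ?thesis
    using assms unfolding eq by simp
qed

section \<open>Metric outer measures in the sense of Caratheodory\<close>

definition metric_outer :: "('a::metric_space set \<Rightarrow> ennreal) \<Rightarrow> bool" where
  "metric_outer \<mu> \<longleftrightarrow> (\<forall>P Q d. d > 0 \<longrightarrow> (\<forall>x\<in>P. \<forall>y\<in>Q. d \<le> dist x y) \<longrightarrow> \<mu> P + \<mu> Q \<le> \<mu> (P \<union> Q))"

lemma infdist_gap: "a + d \<le> infdist x C \<Longrightarrow> infdist y C \<le> a \<Longrightarrow> d \<le> dist x y"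
  using infdist_triangle[of x C y] by simp

text \<open>The gaps \<open>d k\<close> may shrink to 0: the induction splits off one set at a time,
  and each step uses only the gap between that set and the earlier ones.\<close>

lemma metric_outer_sum:
  fixes R :: "nat \<Rightarrow> 'a::metric_space set"
  assumes met: "metric_outer \<mu>"
    and d: "\<And>k. 0 < d k"
    and sep: "\<And>k j x y. j < k \<Longrightarrow> x \<in> R j \<Longrightarrow> y \<in> R k \<Longrightarrow> d k \<le> dist x y"
  shows "(\<Sum>k<n. \<mu> (R k)) \<le> \<mu> (\<Union>k<n. R k)"
proof (induction n)
  case (Suc n)
  have "(\<Sum>k<Suc n. \<mu> (R k)) \<le> \<mu> (\<Union>k<n. R k) + \<mu> (R n)"
    using Suc by (simp add: add_right_mono)
  also have "\<dots> \<le> \<mu> ((\<Union>k<n. R k) \<union> R n)"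
  proof -
    have "\<forall>x\<in>\<Union>k<n. R k. \<forall>y\<in>R n. d n \<le> dist x y"
      using sep by blast
    then show ?thesis
      using met d[of n] unfolding metric_outer_def by blast
  qed
  also have "(\<Union>k<n. R k) \<union> R n = (\<Union>k<Suc n. R k)"
    by (auto simp: less_Suc_eq)
  finally show ?case .
qed simp

text \<open>Caratheodory's criterion. The layers \<open>R k\<close> of equal parity have positive mutual distance,
  so their measures are summable and \<open>\<mu> (E n)\<close> tends to \<open>\<mu> (x - C)\<close>.\<close>

lemma metric_outer_closed:
  fixes \<mu> :: "'a::metric_space set \<Rightarrow> ennreal"
  assumes m: "measure_over \<mu>" and met: "metric_outer \<mu>" and C: "closed C"
  shows "C \<in> caratheodory_sets \<mu>"
\<comment> \<open>\<open>infdist\<close> to the empty set is 0 by convention, so the distance layers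
  below make sense only for nonempty \<open>C\<close>.\<close>
proof (cases "C = {}")
  case True
  then show ?thesis
    using null_caratheodory_sets[OF m] measure_over_empty[OF m] by blast
next
  case ne: False
  show ?thesis
  proof (rule caratheodory_setsI[OF m])
    fix x assume fin: "\<mu> x < \<infinity>"
    define a where "a n = 1 / real (Suc n)" for n
    have a_pos: "a n > 0" for n by (simp add: a_def)
    have a_less: "a k < a j" if "j < k" for j k
      using that by (simp add: a_def frac_less2)
    have a_le: "a k \<le> a j" if "j \<le> k" for j k
      using that a_less by (cases "j = k") (auto simp: less_imp_le)
    define E where "E n = {z\<in>x. a n \<le> infdist z C}" for n
    define R where "R n = E (Suc n) - E n" for n
    have layers: "(\<Sum>k<n. \<mu> (R (2 * k + p))) \<le> \<mu> x" for n p
    proof -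
      have "(\<Sum>k<n. \<mu> (R (2 * k + p))) \<le> \<mu> (\<Union>k<n. R (2 * k + p))"
      proof (rule metric_outer_sum[OF met])
        \<comment> \<open>The gap is the width of the omitted layer \<open>R (2 * k + p - 1)\<close>
          of the other parity. For \<open>k = 0\<close> there is no earlier set, and the value 1
          only has to be positive.\<close>
        define d where "d k = (if k = 0 then 1 else a (2 * k + p - 1) - a (2 * k + p))" for k :: nat
        show "0 < d k" for k
          using a_less[of "2 * k + p - 1" "2 * k + p"] by (auto simp: d_def)
        fix j k :: nat and y z
        assume jk: "j < k" and y: "y \<in> R (2 * j + p)" and z: "z \<in> R (2 * k + p)"
        have "a (2 * k + p - 1) \<le> a (Suc (2 * j + p))"
          using jk by (intro a_le) linarith
        also have "\<dots> \<le> infdist y C"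
          using y by (simp add: R_def E_def)
        finally have "a (2 * k + p) + d k \<le> infdist y C"
          using jk by (simp add: d_def)
        moreover have "infdist z C \<le> a (2 * k + p)"
          using z by (auto simp: R_def E_def)
        ultimately show "d k \<le> dist y z"
          by (rule infdist_gap)
      qed
      also have "\<dots> \<le> \<mu> x"
        by (intro measure_over_mono[OF m]) (auto simp: R_def E_def)
      finally show ?thesis .
    qed
    have half: "(\<Sum>k<2 * n. \<mu> (R k)) = (\<Sum>k<n. \<mu> (R (2 * k + 0))) + (\<Sum>k<n. \<mu> (R (2 * k + 1)))" for n
      by (induction n) (simp_all add: algebra_simps)
    have "(\<Sum>k<n. \<mu> (R k)) \<le> 2 * \<mu> x" for n
    proof -
      have "(\<Sum>k<n. \<mu> (R k)) \<le> (\<Sum>k<2 * n. \<mu> (R k))"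
        by (intro sum_mono2) auto
      also have "\<dots> \<le> \<mu> x + \<mu> x"
        unfolding half by (intro add_mono layers)
      finally show ?thesis by (simp add: mult_2)
    qed
    then have "(\<Sum>k. \<mu> (R k)) \<le> 2 * \<mu> x"
      by (intro suminf_le_const) auto
    then have sfin: "(\<Sum>k. \<mu> (R k)) \<noteq> \<infinity>"
      using fin by (auto simp: top_unique ennreal_mult_eq_top_iff)
    then have tail: "(\<lambda>n. \<Sum>k. \<mu> (R (k + n))) \<longlonglongrightarrow> 0"
      by (rule ennreal_suminf_tail)
    have bound: "\<mu> (x \<inter> C) + \<mu> (x - C) \<le> \<mu> x + (\<Sum>k. \<mu> (R (k + n)))" for n
    proof -
      have "x - C \<subseteq> E n \<union> (\<Union>k. R (k + n))"
      proof
        fix z assume z: "z \<in> x - C"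
        then have "infdist z C > 0"
          using C ne by (simp add: in_closed_iff_infdist_zero infdist_pos_not_in_closed)
        then obtain l where l: "a l < infdist z C"
          unfolding a_def by (rule nat_approx_posE)
        show "z \<in> E n \<union> (\<Union>k. R (k + n))"
        proof (cases "z \<in> E n")
          case False
          have ex: "z \<in> E l"
            using z l by (simp add: E_def)
          \<comment> \<open>The first index at which \<open>z\<close> is far enough from
            \<open>C\<close> exceeds \<open>n\<close>, which places \<open>z\<close> in the layer
            \<open>R (k - 1)\<close>.\<close>
          define k where "k = (LEAST i. z \<in> E i)"
          have k: "z \<in> E k" "\<And>i. i < k \<Longrightarrow> z \<notin> E i"
            unfolding k_def using LeastI[of "\<lambda>i. z \<in> E i", OF ex] not_less_Least by auto
          have "n < k"
          proof (rule ccontr)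
            assume "\<not> n < k"
            then have "z \<in> E n"
              using k(1) a_le[of k n] by (auto simp: E_def)
            with False show False ..
          qed
          then obtain i where "k = Suc (i + n)"
            by (metis add.commute add_Suc_right less_iff_Suc_add)
          with k have "z \<in> R (i + n)"
            by (simp add: R_def)
          then show ?thesis by blast
        qed simp
      qed
      then have "\<mu> (x - C) \<le> \<mu> (E n \<union> (\<Union>k. R (k + n)))"
        by (rule measure_over_mono[OF m])
      also have "\<dots> \<le> \<mu> (E n) + (\<Sum>k. \<mu> (R (k + n)))"
        by (intro order_trans[OF measure_over_Un[OF m]] add_left_mono measure_over_UN[OF m])
      finally have "\<mu> (x \<inter> C) + \<mu> (x - C) \<le> (\<mu> (x \<inter> C) + \<mu> (E n)) + (\<Sum>k. \<mu> (R (k + n)))"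
        by (simp add: add.assoc add_left_mono)
      moreover have "\<mu> (x \<inter> C) + \<mu> (E n) \<le> \<mu> ((x \<inter> C) \<union> E n)"
      proof -
        have "a n \<le> dist y z" if "y \<in> x \<inter> C" "z \<in> E n" for y z
          using that infdist_gap[of 0 "a n" z C y] by (auto simp: E_def dist_commute)
        then show ?thesis
          using met a_pos[of n] unfolding metric_outer_def by blast
      qed
      moreover have "\<mu> ((x \<inter> C) \<union> E n) \<le> \<mu> x"
        by (intro measure_over_mono[OF m]) (auto simp: E_def)
      ultimately show ?thesis
        by (meson add_right_mono order_trans)
    qed
    have "(\<lambda>n. \<mu> x + (\<Sum>k. \<mu> (R (k + n)))) \<longlonglongrightarrow> \<mu> x + 0"
      by (intro tendsto_add tendsto_const tail)
    then show "\<mu> (x \<inter> C) + \<mu> (x - C) \<le> \<mu> x"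
      using bound by (intro Lim_bounded2[of _ "\<mu> x"]) auto
  qed
qed

lemma metric_outer_borel:
  assumes m: "measure_over \<mu>" and met: "metric_outer \<mu>"
  shows "sets borel \<subseteq> caratheodory_sets \<mu>"
proof -
  have "sets (sigma UNIV {S. closed S}) \<subseteq> sets (caratheodory_restriction \<mu>)"
    using metric_outer_closed[OF assms]
    by (intro sigma_le_sets[THEN iffD2]) (auto simp: sets_caratheodory_restriction[OF m] space_caratheodory_restriction)
  then show ?thesis
    by (simp add: sets_caratheodory_restriction[OF m] borel_eq_closed)
qed

section \<open>Approximation by open sets and disjoint subfamilies\<close>

text \<open>Two-sided approximation survives the generation of the Borel sets: an open set is
  exhausted by the closed sets of points at distance at least \<open>1 / Suc n\<close> from its
  complement, complementation exchanges the roles of \<open>C\<close> and \<open>V\<close>, and in a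
  countable union finitely many closed sets are kept. Finiteness gives continuity along decreasing
  sequences. \<open>M\<close> may have more measurable sets than the Borel ones, so that it can come
  from a Caratheodory restriction.\<close>

lemma finite_measure_closed_open:
  fixes M :: "'a::metric_space measure"
  assumes "finite_measure M" and sub: "sets borel \<subseteq> sets M"
    and B: "B \<in> sets borel" and "e > 0"
  shows "\<exists>C V. closed C \<and> open V \<and> C \<subseteq> B \<and> B \<subseteq> V \<and> measure M (V - C) < e"
proof -
  interpret finite_measure M by fact
  have meas [measurable]: "S \<in> sets borel \<Longrightarrow> S \<in> sets M" for S
    using sub by blast
  have "B \<in> sigma_sets UNIV {S. open S}"
    using B by (simp add: borel_def)
  then show ?thesis
    using \<open>e > 0\<close>
  proof (induction arbitrary: e)
    case (Basic B)
    then have op: "open B" by simp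
    show ?case
    \<comment> \<open>For \<open>B = UNIV\<close> the complement is empty, its
      \<open>infdist\<close> is 0, and the sets \<open>C n\<close> would be empty.\<close>
    proof (cases "B = UNIV")
      case True
      with Basic show ?thesis
        by (intro exI[of _ UNIV]) auto
    next
      case False
      define C where "C n = {x. 1 / real (Suc n) \<le> infdist x (- B)}" for n
      have cl: "closed (C n)" for n
        unfolding C_def by (intro closed_Collect_le continuous_intros)
      have CB: "C n \<subseteq> B" for n
      proof
        fix x assume x: "x \<in> C n"
        have "0 < 1 / real (Suc n)" by simp
        also have "\<dots> \<le> infdist x (- B)"
          using x by (simp add: C_def)
        finally show "x \<in> B"
          by (metis ComplI infdist_zero less_irrefl)
      qed
      have "C m \<subseteq> C n" if "m \<le> n" for m n
        using that frac_le[of 1 1 "real (Suc m)" "real (Suc n)"] by (fastforce simp: C_def)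
      then have "decseq (\<lambda>n. B - C n)"
        by (auto simp: decseq_def)
      moreover have "range (\<lambda>n. B - C n) \<subseteq> sets M"
        using op cl by (auto intro!: meas)
      ultimately have "(\<lambda>n. measure M (B - C n)) \<longlonglongrightarrow> measure M (\<Inter>n. B - C n)"
        by (intro finite_Lim_measure_decseq)
      also have "(\<Inter>n. B - C n) = {}"
      proof -
        have False if x: "x \<in> B" "\<And>n. x \<notin> C n" for x
        proof -
          have "0 < infdist x (- B)"
            using x(1) op False by (intro infdist_pos_not_in_closed) auto
          then obtain n where "1 / real (Suc n) < infdist x (- B)"
            by (rule nat_approx_posE)
          then show False
            using x(2)[of n] by (simp add: C_def)
        qed
        then show ?thesis by blast
      qed
      finally have "(\<lambda>n. measure M (B - C n)) \<longlonglongrightarrow> 0"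
        by simp
      from order_tendstoD(2)[OF this \<open>0 < e\<close>] obtain n where "measure M (B - C n) < e"
        by (auto simp: eventually_sequentially)
      then show ?thesis
        using cl CB op by blast
    qed
  next
    case Empty
    then show ?case
      by (intro exI[of _ "{}"]) auto
  next
    case (Compl B)
    from Compl.IH[OF Compl.prems]
    obtain C V where CV: "closed C" "open V" "C \<subseteq> B" "B \<subseteq> V" "measure M (V - C) < e"
      by blast
    have "- C - - V = V - C" by blast
    then show ?case
      using CV by (intro exI[of _ "- V"] exI[of _ "- C"]) (auto simp: open_Compl closed_Compl)
  next
    case (Union B)
    \<comment> \<open>These errors add up to \<open>e / 2\<close>, strictly below \<open>e\<close>.
      The slack pays for cutting the union of the closed sets, which need not be closed, to finitely
      many terms.\<close>
    have "\<forall>i. \<exists>C V. closed C \<and> open V \<and> C \<subseteq> B i \<and> B i \<subseteq> V \<and>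
        measure M (V - C) < e / 2 * (1 / 2) ^ Suc i"
      using Union.prems by (intro allI Union.IH) simp
    then obtain C V where CV: "\<And>i. closed (C i)" "\<And>i. open (V i)" "\<And>i. C i \<subseteq> B i"
        "\<And>i. B i \<subseteq> V i" "\<And>i. measure M (V i - C i) < e / 2 * (1 / 2) ^ Suc i"
      by metis
    have [measurable]: "C i \<in> sets M" "V i \<in> sets M" for i
      using CV by auto
    let ?D = "\<lambda>n. (\<Union>i. V i) - (\<Union>i<n. C i)"
    have sums: "(\<lambda>i. e / 2 * (1 / 2) ^ Suc i) sums (e / 2 * 1)"
      by (intro sums_mult power_half_series)
    have summ: "summable (\<lambda>i. measure M (V i - C i))"
      using CV(5) by (intro summable_comparison_test[OF _ sums_summable[OF sums]])
        (auto simp: less_imp_le intro!: exI[of _ 0])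
    have "measure M (\<Inter>n. ?D n) \<le> measure M (\<Union>i. V i - C i)"
      by (intro finite_measure_mono) auto
    also have "\<dots> \<le> (\<Sum>i. measure M (V i - C i))"
      by (intro finite_measure_subadditive_countably summ) auto
    also have "\<dots> \<le> (\<Sum>i. e / 2 * (1 / 2) ^ Suc i)"
      using CV(5) by (intro suminf_le summ sums_summable[OF sums]) (auto intro: less_imp_le)
    also have "\<dots> < e"
      using sums_unique[OF sums] Union.prems by simp
    finally have lim: "measure M (\<Inter>n. ?D n) < e" .
    have "(\<lambda>n. measure M (?D n)) \<longlonglongrightarrow> measure M (\<Inter>n. ?D n)"
    proof (rule finite_Lim_measure_decseq)
      show "range ?D \<subseteq> sets M" by auto
      show "decseq ?D"
        unfolding decseq_def by (intro allI impI Diff_mono UN_mono) auto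
    qed
    from order_tendstoD(2)[OF this lim] obtain n where "measure M (?D n) < e"
      by (auto simp: eventually_sequentially)
    moreover have "closed (\<Union>i<n. C i)" "open (\<Union>i. V i)"
      using CV by auto
    moreover have "(\<Union>i<n. C i) \<subseteq> (\<Union>i. B i)"
      using CV(3) by (intro UN_mono) auto
    moreover have "(\<Union>i. B i) \<subseteq> (\<Union>i. V i)"
      using CV(4) by (intro UN_mono) auto
    ultimately show ?case
      by (intro exI[of _ "\<Union>i<n. C i"] exI[of _ "\<Union>i. V i"]) simp
  qed
qed

text \<open>\<open>E\<close> is replaced by a Borel hull \<open>H\<close>, which is approximated for
  the finite measure \<open>M\<close>, the restriction of \<open>\<mu>\<close> to \<open>U\<close>.
  Neither \<open>H\<close> nor the approximating open set need lie in \<open>U\<close>; only their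
  traces on \<open>U\<close> count, and the trace of the open set is what is returned.\<close>

lemma borel_regular_outer_open:
  fixes \<mu> :: "'a::metric_space set \<Rightarrow> ennreal"
  assumes m: "measure_over \<mu>" and b: "borel_regular \<mu>"
    and U: "open U" "\<mu> U < \<infinity>" "E \<subseteq> U" and e: "e > 0"
  obtains V where "open V" "E \<subseteq> V" "V \<subseteq> U" "\<mu> V \<le> \<mu> E + ennreal e"
proof -
  let ?N = "caratheodory_restriction \<mu>"
  define M where "M = density ?N (indicator U)"
  have sets: "sets M = sets ?N"
    by (simp add: M_def)
  have bor: "S \<in> sets ?N" if "S \<in> sets borel" for S
    using b that unfolding borel_regular_def sets_caratheodory_restriction[OF m] by blast
  have UN: "U \<in> sets ?N"
    using U(1) by (intro bor) auto
  have N: "emeasure ?N S = \<mu> S" if "S \<in> sets ?N" for S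
    using that unfolding sets_caratheodory_restriction[OF m] by (rule emeasure_caratheodory_restriction[OF m])
  have M: "emeasure M S = \<mu> (U \<inter> S)" if "S \<in> sets ?N" for S
    using that UN unfolding M_def by (subst emeasure_density) (auto simp: N simp flip: indicator_inter_arith)
  have "finite_measure M"
    using U(2) M[of UNIV] sets.top[of ?N]
    by (intro finite_measureI) (auto simp: M_def space_caratheodory_restriction)
  then interpret finite_measure M .
  obtain H where H: "H \<in> sets borel" "E \<subseteq> H" "\<mu> H = \<mu> E"
    using b unfolding borel_regular_def by blast
  have "sets borel \<subseteq> sets M"
    using bor sets by blast
  from finite_measure_closed_open[OF \<open>finite_measure M\<close> this H(1) e]
  obtain C V where CV: "closed C" "open V" "C \<subseteq> H" "H \<subseteq> V" "measure M (V - C) < e"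
    by blast
  have [measurable]: "V \<in> sets M" "C \<in> sets M" "H \<in> sets M"
    using CV H bor sets by auto
  have "\<mu> (U \<inter> V) = emeasure M V"
    using M CV(2) bor by simp
  also have "\<dots> \<le> emeasure M (H \<union> (V - C))"
    using CV by (intro emeasure_mono) auto
  also have "\<dots> \<le> emeasure M H + emeasure M (V - C)"
    by (rule emeasure_subadditive) auto
  also have "\<dots> \<le> \<mu> E + ennreal e"
  proof (rule add_mono)
    have "emeasure M H = \<mu> (U \<inter> H)"
      using H(1) bor M by blast
    also have "\<dots> \<le> \<mu> H"
      by (intro measure_over_mono[OF m]) blast
    finally show "emeasure M H \<le> \<mu> E"
      using H(3) by simp
    show "emeasure M (V - C) \<le> ennreal e"
      using CV(5) by (simp add: emeasure_eq_measure ennreal_leI)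
  qed
  finally show thesis
    using that[of "U \<inter> V"] U CV H by auto
qed

text \<open>Zorn's lemma is applied to the disjoint subfamilies \<open>\<H>\<close> such that every
  member of \<open>\<F>\<close> meeting a member of \<open>\<H>\<close> already meets one of at
  least half its size. If a maximal one missed some member of \<open>\<F>\<close>, then among all
  members that it misses a set \<open>W\<close> of at least half the supremal size could be added.
  The bound \<open>b\<close> makes this supremum finite; the factor 2 appears because it need not be
  attained.\<close>

lemma Vitali_disjoint_subfamily:
  fixes \<delta> :: "'a set \<Rightarrow> real"
  assumes \<delta>: "\<And>S. S \<in> \<F> \<Longrightarrow> 0 \<le> \<delta> S \<and> \<delta> S \<le> b" and ne: "{} \<notin> \<F>"
  obtains \<G> where "\<G> \<subseteq> \<F>" "disjoint \<G>"
    "\<And>S. S \<in> \<F> \<Longrightarrow> \<exists>T\<in>\<G>. S \<inter> T \<noteq> {} \<and> \<delta> S \<le> 2 * \<delta> T"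
proof -
  define \<Omega> where "\<Omega> = {\<H>. \<H> \<subseteq> \<F> \<and> disjoint \<H> \<and>
    (\<forall>S\<in>\<F>. (\<exists>T\<in>\<H>. S \<inter> T \<noteq> {}) \<longrightarrow> (\<exists>T\<in>\<H>. S \<inter> T \<noteq> {} \<and> \<delta> S \<le> 2 * \<delta> T))}"
  have "\<exists>\<G>\<in>\<Omega>. \<forall>\<H>\<in>\<Omega>. \<G> \<subseteq> \<H> \<longrightarrow> \<H> = \<G>"
  proof (rule subset_Zorn_nonempty)
    have "{} \<in> \<Omega>"
      by (simp add: \<Omega>_def)
    then show "\<Omega> \<noteq> {}" by blast
    fix \<C> assume "\<C> \<noteq> {}" and ch: "subset.chain \<Omega> \<C>"
    have sub: "\<C> \<subseteq> \<Omega>"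
      using ch by (simp add: subset.chain_def)
    have "disjoint (\<Union>\<C>)"
    proof (rule disjointI)
      fix S T assume ST: "S \<in> \<Union>\<C>" "T \<in> \<Union>\<C>" "S \<noteq> T"
      then obtain \<H> \<H>' where "\<H> \<in> \<C>" "S \<in> \<H>" "\<H>' \<in> \<C>" "T \<in> \<H>'"
        by blast
      then obtain \<K> where "\<K> \<in> \<C>" "S \<in> \<K>" "T \<in> \<K>"
        using subset.chain_total[OF ch, of \<H> \<H>'] by blast
      moreover have "disjoint \<K>"
        using \<open>\<K> \<in> \<C>\<close> sub by (auto simp: \<Omega>_def)
      ultimately show "S \<inter> T = {}"
        using ST(3) by (meson disjointD)
    qed
    moreover have "\<exists>T\<in>\<Union>\<C>. S \<inter> T \<noteq> {} \<and> \<delta> S \<le> 2 * \<delta> T"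
      if S: "S \<in> \<F>" and ex: "\<exists>T\<in>\<Union>\<C>. S \<inter> T \<noteq> {}" for S
    proof -
      obtain \<H> T where H: "\<H> \<in> \<C>" "T \<in> \<H>" "S \<inter> T \<noteq> {}"
        using ex by blast
      then have "\<H> \<in> \<Omega>"
        using sub by blast
      then have "\<exists>T\<in>\<H>. S \<inter> T \<noteq> {} \<and> \<delta> S \<le> 2 * \<delta> T"
        unfolding \<Omega>_def using S H(2,3) by blast
      then show ?thesis
        using H(1) by blast
    qed
    moreover have "\<Union>\<C> \<subseteq> \<F>"
      using sub by (auto simp: \<Omega>_def)
    ultimately show "\<Union>\<C> \<in> \<Omega>"
      by (simp add: \<Omega>_def)
  qed
  then obtain \<G> where G: "\<G> \<in> \<Omega>" and max: "\<And>\<H>. \<H> \<in> \<Omega> \<Longrightarrow> \<G> \<subseteq> \<H> \<Longrightarrow> \<H> = \<G>"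
    by blast
  have meets: "\<exists>T\<in>\<G>. S \<inter> T \<noteq> {}" if S: "S \<in> \<F>" for S
  proof (rule ccontr)
    assume none: "\<not> ?thesis"
    define \<K> where "\<K> = {S\<in>\<F>. \<forall>T\<in>\<G>. S \<inter> T = {}}"
    have SK: "S \<in> \<K>"
      using none S by (auto simp: \<K>_def)
    have bdd: "bdd_above (\<delta> ` \<K>)"
      using \<delta> by (intro bdd_aboveI[of _ b]) (auto simp: \<K>_def)
    define s where "s = (SUP S\<in>\<K>. \<delta> S)"
    have le_s: "\<delta> T \<le> s" if "T \<in> \<K>" for T
      unfolding s_def using that bdd by (rule cSUP_upper)
    have "\<exists>W\<in>\<K>. s \<le> 2 * \<delta> W"
    proof (cases "s \<le> 0")
      case True
      then show ?thesis
        using SK \<delta>[OF S] by (intro bexI[of _ S]) auto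
    next
      case False
      then have "s / 2 < (SUP S\<in>\<K>. \<delta> S)"
        by (simp add: s_def)
      then obtain W where "W \<in> \<K>" "s / 2 < \<delta> W"
        using less_cSUP_iff[OF _ bdd] SK by blast
      then show ?thesis
        by (intro bexI[of _ W]) auto
    qed
    then obtain W where W: "W \<in> \<K>" "s \<le> 2 * \<delta> W"
      by blast
    then have WF: "W \<in> \<F>" and Wdisj: "\<And>T. T \<in> \<G> \<Longrightarrow> W \<inter> T = {}"
      by (auto simp: \<K>_def)
    have "insert W \<G> \<in> \<Omega>"
      unfolding \<Omega>_def mem_Collect_eq
    proof (intro conjI ballI impI)
      show "insert W \<G> \<subseteq> \<F>"
        using G WF by (auto simp: \<Omega>_def)
      show "disjoint (insert W \<G>)"
        using G Wdisj by (auto simp: \<Omega>_def pairwise_insert disjnt_def disjoint_def)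
      fix R assume R: "R \<in> \<F>" "\<exists>T\<in>insert W \<G>. R \<inter> T \<noteq> {}"
      show "\<exists>T\<in>insert W \<G>. R \<inter> T \<noteq> {} \<and> \<delta> R \<le> 2 * \<delta> T"
      proof (cases "\<exists>T\<in>\<G>. R \<inter> T \<noteq> {}")
        case True
        then show ?thesis
          using G R(1) by (auto simp: \<Omega>_def)
      next
        case False
        then have "R \<in> \<K>"
          using R(1) by (auto simp: \<K>_def)
        then have "\<delta> R \<le> 2 * \<delta> W"
          using le_s W(2) order_trans by blast
        then show ?thesis
          using False R(2) by blast
      qed
    qed
    then have "insert W \<G> = \<G>"
      using max by (simp add: subset_insertI)
    \<comment> \<open>\<open>W\<close> misses every member of \<open>\<G>\<close>, now including
      itself; excluding the empty set from \<open>\<F>\<close> makes this a contradiction.\<close>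
    then have "W \<in> \<G>"
      by (metis insertI1)
    then have "W = {}"
      using Wdisj[of W] by simp
    then show False
      using WF ne by simp
  qed
  show thesis
  proof (rule that)
    show "\<G> \<subseteq> \<F>" "disjoint \<G>"
      using G by (auto simp: \<Omega>_def)
    show "\<exists>T\<in>\<G>. S \<inter> T \<noteq> {} \<and> \<delta> S \<le> 2 * \<delta> T" if "S \<in> \<F>" for S
      using G that meets[OF that] by (simp add: \<Omega>_def)
  qed
qed

section \<open>Closed balls and the spherical measure\<close>

lemma metric_diameter_le:
  fixes S :: "'a::metric_space set"
  assumes "0 \<le> d" "\<And>x y. x \<in> S \<Longrightarrow> y \<in> S \<Longrightarrow> dist x y \<le> d"
  shows "diameter S \<le> d"
  using assms by (auto simp: diameter_def intro: cSUP_least)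

lemma cball_in_closed_balls: "r > 0 \<Longrightarrow> cball y r \<in> closed_balls"
  unfolding closed_balls_def by blast

lemma closed_balls_bounded: "S \<in> closed_balls \<Longrightarrow> bounded S"
  and closed_balls_closed: "S \<in> closed_balls \<Longrightarrow> closed S"
  and closed_balls_nonempty: "S \<in> closed_balls \<Longrightarrow> S \<noteq> {}"
  by (auto simp: closed_balls_def)

lemma closed_balls_diameter_nonneg: "S \<in> closed_balls \<Longrightarrow> 0 \<le> diameter S"
  by (simp add: closed_balls_bounded diameter_ge_0)

lemma closed_balls_subset_ball:
  assumes "S \<in> closed_balls" "x \<in> S" "diameter S < r"
  shows "S \<subseteq> ball x r"
  using diameter_bounded_bound[OF closed_balls_bounded[OF assms(1)] assms(2)] assms(3)
  by fastforce

text \<open>The radius of a ball may be much larger than its diameter \<open>d\<close>; the enlargement is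
  therefore \<open>cball y (3 * d)\<close>, except for \<open>d = 0\<close>, where the ball is a singleton.\<close>

lemma closed_balls_enlarge:
  assumes T: "T \<in> closed_balls"
  obtains T' where "T' \<in> closed_balls" "diameter T' \<le> 6 * diameter T"
    "\<And>S. bounded S \<Longrightarrow> S \<inter> T \<noteq> {} \<Longrightarrow> diameter S \<le> 2 * diameter T \<Longrightarrow> S \<subseteq> T'"
proof (cases "diameter T = 0")
  case True
  show thesis
  proof (rule that[of T])
    show "S \<subseteq> T" if S: "bounded S" "S \<inter> T \<noteq> {}" "diameter S \<le> 2 * diameter T" for S
    proof
      fix x assume x: "x \<in> S"
      obtain z where z: "z \<in> S" "z \<in> T" using S(2) by blast
      have "dist x z \<le> 0"
        using diameter_bounded_bound[OF S(1) x z(1)] S(3) True by linarith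
      then show "x \<in> T" using z by simp
    qed
  qed (use T True in auto)
next
  case False
  then have d: "diameter T > 0"
    using closed_balls_diameter_nonneg[OF T] by simp
  obtain y r where yr: "T = cball y r" "r > 0"
    using T by (auto simp: closed_balls_def)
  then have yT: "y \<in> T" by simp
  show thesis
  proof (rule that[of "cball y (3 * diameter T)"])
    show "cball y (3 * diameter T) \<in> closed_balls"
      using d by (intro cball_in_closed_balls) simp
    show "diameter (cball y (3 * diameter T)) \<le> 6 * diameter T"
    proof (rule metric_diameter_le)
      fix u v assume "u \<in> cball y (3 * diameter T)" "v \<in> cball y (3 * diameter T)"
      then show "dist u v \<le> 6 * diameter T"
        using dist_triangle[of u v y] by (simp add: dist_commute)
    qed (use d in simp)
    show "S \<subseteq> cball y (3 * diameter T)"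
      if S: "bounded S" "S \<inter> T \<noteq> {}" "diameter S \<le> 2 * diameter T" for S
    proof
      fix x assume x: "x \<in> S"
      obtain z where z: "z \<in> S" "z \<in> T" using S(2) by blast
      have "dist x z \<le> 2 * diameter T"
        using diameter_bounded_bound[OF S(1) x z(1)] S(3) by simp
      moreover have "dist y z \<le> diameter T"
        using diameter_bounded_bound[OF closed_balls_bounded[OF T] yT z(2)] .
      ultimately show "x \<in> cball y (3 * diameter T)"
        using dist_triangle[of y x z] by (simp add: dist_commute)
    qed
  qed
qed

lemma zeta_b_less_top: "zeta_b c \<alpha> S < top"
  by (simp add: zeta_b_def)

lemma zeta_b_scale:
  assumes "c > 0" "\<alpha> > 0" "0 \<le> diameter S" "0 \<le> diameter T" "diameter S \<le> k * diameter T" "0 \<le> k"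
  shows "zeta_b c \<alpha> S \<le> ennreal (k powr \<alpha>) * zeta_b c \<alpha> T"
proof -
  have "diameter S powr \<alpha> \<le> (k * diameter T) powr \<alpha>"
    using assms by (intro powr_mono2) auto
  also have "\<dots> = k powr \<alpha> * diameter T powr \<alpha>"
    using assms by (simp add: powr_mult)
  finally have "c * diameter S powr \<alpha> \<le> k powr \<alpha> * (c * diameter T powr \<alpha>)"
    using assms(1) by (simp add: mult.left_commute)
  then show ?thesis
    by (simp add: zeta_b_def ennreal_leI assms(1) less_imp_le flip: ennreal_mult)
qed

lemma spherical_pre_antimono:
  assumes "\<delta> \<le> \<delta>'"
  shows "spherical_pre c \<alpha> \<delta>' R \<le> spherical_pre c \<alpha> \<delta> R"
  unfolding spherical_pre_def
proof (rule Inf_superset_mono, rule subsetI, elim CollectE exE conjE)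
  fix v and J :: "nat set" and E
  assume "v = (\<Sum>j. if j \<in> J then zeta_b c \<alpha> (E j) else 0)"
    and "\<forall>j\<in>J. E j \<in> closed_balls \<and> diameter (E j) \<le> \<delta>" and "R \<subseteq> (\<Union>j\<in>J. E j)"
  with assms show "v \<in> {(\<Sum>j. if j \<in> J then zeta_b c \<alpha> (E j) else 0) | (J :: nat set) E.
            (\<forall>j\<in>J. E j \<in> closed_balls \<and> diameter (E j) \<le> \<delta>') \<and> R \<subseteq> (\<Union>j\<in>J. E j)}"
    by (intro CollectI exI[of _ J] exI[of _ E]) (auto intro: order_trans)
qed

lemma spherical_pre_le_measure: "\<delta> > 0 \<Longrightarrow> spherical_pre c \<alpha> \<delta> R \<le> spherical_measure c \<alpha> R"
  unfolding spherical_measure_def by (rule SUP_upper) simp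

lemma spherical_pre_lessE:
  assumes "spherical_pre c \<alpha> \<delta> R < v"
  obtains J E where "\<And>j. j \<in> J \<Longrightarrow> E j \<in> closed_balls" "\<And>j. j \<in> J \<Longrightarrow> diameter (E j) \<le> \<delta>"
    "R \<subseteq> (\<Union>j\<in>J. E j)" "(\<Sum>j. if j \<in> J then zeta_b c \<alpha> (E j) else 0) < v"
  using assms unfolding spherical_pre_def Inf_less_iff mem_Collect_eq by blast

lemma spherical_pre_greatest:
  assumes "\<And>J E. (\<And>j. j \<in> J \<Longrightarrow> E j \<in> closed_balls) \<Longrightarrow> (\<And>j. j \<in> J \<Longrightarrow> diameter (E j) \<le> \<delta>) \<Longrightarrow>
    R \<subseteq> (\<Union>j\<in>J. E j) \<Longrightarrow> v \<le> (\<Sum>j. if j \<in> J then zeta_b c \<alpha> (E j) else 0)"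
  shows "v \<le> spherical_pre c \<alpha> \<delta> R"
proof (rule ccontr)
  assume "\<not> ?thesis"
  then have "spherical_pre c \<alpha> \<delta> R < v" by simp
  then show False
  proof (rule spherical_pre_lessE)
    fix J :: "nat set" and E
    assume "\<And>j. j \<in> J \<Longrightarrow> E j \<in> closed_balls" "\<And>j. j \<in> J \<Longrightarrow> diameter (E j) \<le> \<delta>"
      "R \<subseteq> (\<Union>j\<in>J. E j)" "(\<Sum>j. if j \<in> J then zeta_b c \<alpha> (E j) else 0) < v"
    then show False
      using assms[of J E] by simp
  qed
qed

text \<open>A ball of diameter below \<open>d\<close> cannot meet both \<open>P\<close> and
  \<open>Q\<close>, so a covering of the union splits into a covering of each with no ball counted
  twice.\<close>

lemma spherical_pre_metric:
  assumes "\<And>x y. x \<in> P \<Longrightarrow> y \<in> Q \<Longrightarrow> d \<le> dist x y" "\<delta> < d"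
  shows "spherical_pre c \<alpha> \<delta> P + spherical_pre c \<alpha> \<delta> Q \<le> spherical_pre c \<alpha> \<delta> (P \<union> Q)"
proof (rule spherical_pre_greatest)
  fix J :: "nat set" and E
  assume cb: "\<And>j. j \<in> J \<Longrightarrow> E j \<in> closed_balls" and diam: "\<And>j. j \<in> J \<Longrightarrow> diameter (E j) \<le> \<delta>"
    and cov: "P \<union> Q \<subseteq> (\<Union>j\<in>J. E j)"
  define K where "K R = {j\<in>J. E j \<inter> R \<noteq> {}}" for R
  have disj: "\<not> (j \<in> K P \<and> j \<in> K Q)" for j
  proof
    assume "j \<in> K P \<and> j \<in> K Q"
    then obtain x y where "j \<in> J" "x \<in> E j" "x \<in> P" "y \<in> E j" "y \<in> Q"
      by (auto simp: K_def)
    then have "d \<le> dist x y" "dist x y \<le> \<delta>"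
      using assms(1) diameter_bounded_bound[OF closed_balls_bounded[OF cb]] diam
      by (blast intro: order_trans)+
    with assms(2) show False by simp
  qed
  have "spherical_pre c \<alpha> \<delta> R \<le> (\<Sum>j. if j \<in> K R then zeta_b c \<alpha> (E j) else 0)" if "R \<subseteq> P \<union> Q" for R
  proof (rule spherical_pre_le)
    show "E j \<in> closed_balls \<and> diameter (E j) \<le> \<delta>" if "j \<in> K R" for j
      using that cb diam by (auto simp: K_def)
    show "R \<subseteq> (\<Union>j\<in>K R. E j)"
      using cov that by (fastforce simp: K_def)
  qed
  then have "spherical_pre c \<alpha> \<delta> P + spherical_pre c \<alpha> \<delta> Q \<le>
      (\<Sum>j. if j \<in> K P then zeta_b c \<alpha> (E j) else 0) + (\<Sum>j. if j \<in> K Q then zeta_b c \<alpha> (E j) else 0)"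
    by (intro add_mono) auto
  also have "\<dots> = (\<Sum>j. (if j \<in> K P then zeta_b c \<alpha> (E j) else 0) + (if j \<in> K Q then zeta_b c \<alpha> (E j) else 0))"
    by (rule suminf_add) auto
  also have "\<dots> \<le> (\<Sum>j. if j \<in> J then zeta_b c \<alpha> (E j) else 0)"
    using disj by (intro suminf_le) (auto simp: K_def)
  finally show "spherical_pre c \<alpha> \<delta> P + spherical_pre c \<alpha> \<delta> Q \<le> \<dots>" .
qed

lemma metric_outer_spherical_measure: "metric_outer (spherical_measure c \<alpha>)"
  unfolding metric_outer_def
proof (intro allI impI)
  fix P Q :: "'a set" and d :: real
  assume d: "d > 0" and sep: "\<forall>x\<in>P. \<forall>y\<in>Q. d \<le> dist x y"
  let ?p = "spherical_pre c \<alpha>" and ?S = "spherical_measure c \<alpha>"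
  have le: "?p \<delta> P + ?p \<delta>' Q \<le> ?S (P \<union> Q)" if "\<delta> > 0" "\<delta>' > 0" for \<delta> \<delta>'
  proof -
    \<comment> \<open>Two independent scales allow the two suprema to be taken one after the other.
      \<open>\<eta>\<close> is a common finer scale, and \<open>d / 2\<close> keeps it strictly
      below the separation.\<close>
    define \<eta> where "\<eta> = min (min \<delta> \<delta>') (d / 2)"
    have \<eta>: "\<eta> > 0" "\<eta> \<le> \<delta>" "\<eta> \<le> \<delta>'" "\<eta> < d"
      using d that by (auto simp: \<eta>_def min_def)
    have "?p \<delta> P + ?p \<delta>' Q \<le> ?p \<eta> P + ?p \<eta> Q"
      using \<eta> by (intro add_mono spherical_pre_antimono)
    also have "\<dots> \<le> ?p \<eta> (P \<union> Q)"
      using sep \<eta>(4) by (intro spherical_pre_metric) auto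
    also have "\<dots> \<le> ?S (P \<union> Q)"
      by (rule spherical_pre_le_measure[OF \<eta>(1)])
    finally show ?thesis .
  qed
  have ne: "{0<..} \<noteq> ({} :: real set)"
    using gt_ex by auto
  have "?S P + ?p \<delta>' Q \<le> ?S (P \<union> Q)" if "\<delta>' > 0" for \<delta>'
    unfolding spherical_measure_def[of c \<alpha> P] ennreal_SUP_add_left[OF ne, symmetric]
    using le[OF _ that] by (intro SUP_least) simp
  then show "?S P + ?S Q \<le> ?S (P \<union> Q)"
    unfolding spherical_measure_def[of c \<alpha> Q] ennreal_SUP_add_right[OF ne]
    by (intro SUP_least) auto
qed

text \<open>Near-optimal coverings at scale \<open>1 / Suc n\<close> are countable unions of closed
  balls, hence Borel. Their intersection over \<open>n\<close> is a hull, because at any given scale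
  it costs no more than one of these coverings with large \<open>n\<close>.\<close>

lemma spherical_measure_hull:
  fixes E :: "'a::metric_space set"
  shows "\<exists>H\<in>sets borel. E \<subseteq> H \<and> spherical_measure c \<alpha> H = spherical_measure c \<alpha> E"
proof (cases "spherical_measure c \<alpha> E = \<infinity>")
  case True
  have "spherical_measure c \<alpha> E \<le> spherical_measure c \<alpha> (UNIV :: 'a set)"
    by (intro measure_over_mono[OF measure_over_spherical_measure]) simp
  then have "spherical_measure c \<alpha> (UNIV :: 'a set) = spherical_measure c \<alpha> E"
    using True by (simp add: top_unique)
  then show ?thesis
    by (intro bexI[of _ UNIV]) auto
next
  case False
  let ?p = "spherical_pre c \<alpha>" and ?S = "spherical_measure c \<alpha>"
  define r where "r n = 1 / real (Suc n)" for n
  have r: "r n > 0" for n by (simp add: r_def)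
  have "\<exists>H. H \<in> sets borel \<and> E \<subseteq> H \<and> ?p (r n) H \<le> ?S E + ennreal (r n)" for n
  proof -
    have "?p (r n) E \<le> ?S E"
      by (rule spherical_pre_le_measure[OF r])
    moreover have "?S E < ?S E + ennreal (r n)"
      using False r[of n] by (simp add: top.not_eq_extremum)
    ultimately have "?p (r n) E < ?S E + ennreal (r n)"
      by (rule le_less_trans)
    then obtain J F where JF: "\<And>j. j \<in> J \<Longrightarrow> F j \<in> closed_balls" "\<And>j. j \<in> J \<Longrightarrow> diameter (F j) \<le> r n"
      "E \<subseteq> (\<Union>j\<in>J. F j)" "(\<Sum>j. if j \<in> J then zeta_b c \<alpha> (F j) else 0) < ?S E + ennreal (r n)"
      by (rule spherical_pre_lessE) blast
    have "?p (r n) (\<Union>j\<in>J. F j) \<le> (\<Sum>j. if j \<in> J then zeta_b c \<alpha> (F j) else 0)"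
      using JF by (intro spherical_pre_le) auto
    moreover have "(\<Union>j\<in>J. F j) \<in> sets borel"
      using JF(1) by (intro sets.countable_UN') (auto intro: borel_closed closed_balls_closed)
    ultimately show ?thesis
      using JF(3,4) by (intro exI[of _ "\<Union>j\<in>J. F j"]) auto
  qed
  then obtain H where H: "\<And>n. H n \<in> sets borel" "\<And>n. E \<subseteq> H n"
      "\<And>n. ?p (r n) (H n) \<le> ?S E + ennreal (r n)"
    by metis
  show ?thesis
  proof (intro bexI conjI antisym)
    show "(\<Inter>n. H n) \<in> sets borel"
      using H(1) by auto
    show E: "E \<subseteq> (\<Inter>n. H n)"
      using H(2) by blast
    show "?S E \<le> ?S (\<Inter>n. H n)"
      by (rule measure_over_mono[OF measure_over_spherical_measure E])
    show "?S (\<Inter>n. H n) \<le> ?S E"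
      unfolding spherical_measure_def[of c \<alpha> "\<Inter>n. H n"]
    proof (rule SUP_least)
      fix \<delta> :: real assume "\<delta> \<in> {0<..}"
      show "?p \<delta> (\<Inter>n. H n) \<le> ?S E"
      proof (rule ennreal_le_epsilon)
        fix e :: real assume "e > 0"
        then have "0 < min \<delta> e"
          using \<open>\<delta> \<in> {0<..}\<close> by simp
        then obtain n where n: "r n < min \<delta> e"
          unfolding r_def by (rule nat_approx_posE)
        have "?p \<delta> (\<Inter>n. H n) \<le> ?p (r n) (\<Inter>n. H n)"
          using n by (intro spherical_pre_antimono) simp
        also have "\<dots> \<le> ?p (r n) (H n)"
          by (intro spherical_pre_mono) blast
        also have "\<dots> \<le> ?S E + ennreal (r n)"
          by (rule H(3))
        also have "\<dots> \<le> ?S E + ennreal e"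
          using n by (intro add_left_mono ennreal_leI) simp
        finally show "?p \<delta> (\<Inter>n. H n) \<le> ?S E + ennreal e" .
      qed
    qed
  qed
qed

lemma borel_regular_spherical_measure: "borel_regular (spherical_measure c \<alpha>)"
  unfolding borel_regular_def
  using metric_outer_borel[OF measure_over_spherical_measure metric_outer_spherical_measure]
    spherical_measure_hull by blast

section \<open>The Federer density\<close>

text \<open>The conventions for degenerate balls disappear in the inequality on the right. A ball
  with \<open>\<zeta> = 0\<close> belongs to the family exactly when its \<open>\<mu>\<close> is
  positive, and its quotient is infinite, so both sides say that \<open>\<mu> S\<close> is positive.
  Otherwise \<open>\<zeta>\<close> is positive and finite and can be multiplied out.\<close>

lemma quotient_fun_gt_iff:
  assumes "S \<in> closed_balls"
  shows "S \<in> nondegenerate_family closed_balls \<mu> (zeta_b c \<alpha>) \<and>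
      ennreal t < quotient_fun \<mu> (zeta_b c \<alpha>) S \<longleftrightarrow> ennreal t * zeta_b c \<alpha> S < \<mu> S"
proof (cases "zeta_b c \<alpha> S = 0")
  case True
  then show ?thesis
    using assms by (auto simp: nondegenerate_family_def quotient_fun_def zero_less_iff_neq_zero)
next
  case False
  let ?z = "zeta_b c \<alpha> S"
  have top: "?z \<noteq> top"
    using zeta_b_less_top[of c \<alpha> S] by simp
  then have nd: "S \<in> nondegenerate_family closed_balls \<mu> (zeta_b c \<alpha>)"
    using assms False by (simp add: nondegenerate_family_def)
  have "\<mu> S / ?z \<le> ennreal t \<longleftrightarrow> ?z * (\<mu> S / ?z) \<le> ?z * ennreal t"
    using False top by (simp add: ennreal_mult_le_mult_iff)
  also have "?z * (\<mu> S / ?z) = \<mu> S"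
    using ennreal_mult_divide_eq[OF False top, of "\<mu> S"] by (simp add: ennreal_times_divide mult.commute)
  finally show ?thesis
    using nd False by (auto simp: quotient_fun_def not_le[symmetric] mult.commute)
qed

lemma federer_density_gtD:
  assumes "ennreal t < federer_density c \<alpha> \<mu> x" "\<epsilon> > 0"
  obtains S where "S \<in> closed_balls" "x \<in> S" "diameter S < \<epsilon>" "ennreal t * zeta_b c \<alpha> S < \<mu> S"
proof -
  let ?\<G> = "{S \<in> nondegenerate_family closed_balls \<mu> (zeta_b c \<alpha>). x \<in> S \<and> diameter S < \<epsilon>}"
  have "ennreal t < (SUP S\<in>?\<G>. quotient_fun \<mu> (zeta_b c \<alpha>) S)"
    using assms(1) unfolding federer_density_def
    by (rule less_le_trans) (rule INF_lower, use assms(2) in simp)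
  then obtain S where S: "S \<in> ?\<G>" "ennreal t < quotient_fun \<mu> (zeta_b c \<alpha>) S"
    by (auto simp: less_SUP_iff)
  then have "S \<in> closed_balls"
    by (simp add: nondegenerate_family_def)
  then show thesis
    using that[of S] S quotient_fun_gt_iff[of S \<mu> c \<alpha> t] by auto
qed

lemma federer_density_lessD:
  assumes "federer_density c \<alpha> \<mu> x < ennreal t"
  obtains \<epsilon> where "\<epsilon> > 0"
    "\<And>S. S \<in> closed_balls \<Longrightarrow> x \<in> S \<Longrightarrow> diameter S < \<epsilon> \<Longrightarrow> \<mu> S \<le> ennreal t * zeta_b c \<alpha> S"
proof -
  let ?\<G> = "\<lambda>\<epsilon>. {S \<in> nondegenerate_family closed_balls \<mu> (zeta_b c \<alpha>). x \<in> S \<and> diameter S < \<epsilon>}"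
  obtain \<epsilon> where \<epsilon>: "\<epsilon> > 0" "(SUP S\<in>?\<G> \<epsilon>. quotient_fun \<mu> (zeta_b c \<alpha>) S) < ennreal t"
    using assms unfolding federer_density_def INF_less_iff by auto
  show thesis
  proof (rule that[OF \<epsilon>(1)])
    fix S assume S: "S \<in> closed_balls" "x \<in> S" "diameter S < \<epsilon>"
    show "\<mu> S \<le> ennreal t * zeta_b c \<alpha> S"
    proof (rule ccontr)
      assume "\<not> ?thesis"
      then have "S \<in> ?\<G> \<epsilon>" "ennreal t < quotient_fun \<mu> (zeta_b c \<alpha>) S"
        using S quotient_fun_gt_iff[OF S(1), of \<mu> c \<alpha> t] by auto
      moreover from this(1) have "quotient_fun \<mu> (zeta_b c \<alpha>) S \<le> (SUP S\<in>?\<G> \<epsilon>. quotient_fun \<mu> (zeta_b c \<alpha>) S)"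
        by (rule SUP_upper)
      ultimately show False
        using \<epsilon>(2) by (meson less_asym less_le_trans)
    qed
  qed
qed

text \<open>Here diametric regularity enters: a ball with \<open>\<mu> S > t * \<zeta> S\<close> can be enlarged slightly
  without destroying the strict inequality, and the enlarged ball is a neighbourhood of \<open>x\<close>.\<close>

lemma exceeding_ball_neighbourhood:
  fixes \<mu> :: "'a::metric_space set \<Rightarrow> ennreal"
  assumes m: "measure_over \<mu>" and c: "c > 0" and \<alpha>: "\<alpha> > 0" and t: "t \<ge> 0"
    and reg: "diametrically_regular TYPE('a)"
    and small: "\<And>e. e > 0 \<Longrightarrow> \<exists>S\<in>closed_balls. x \<in> S \<and> diameter S < e \<and> ennreal t * zeta_b c \<alpha> S < \<mu> S"
    and e: "e > 0"
  obtains S where "S \<in> closed_balls" "x \<in> interior S" "diameter S < e" "ennreal t * zeta_b c \<alpha> S < \<mu> S"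
proof -
  obtain R \<delta> where R: "R > 0" and \<delta>: "\<delta> > 0"
    and cont: "\<And>y. y \<in> ball x R \<Longrightarrow> continuous_on {0<..<\<delta>} (\<lambda>r. diameter (ball y r))"
    using reg unfolding diametrically_regular_def by metis
  \<comment> \<open>The bound \<open>R\<close> on the diameter brings the centre of \<open>S\<close>
    into \<open>ball x R\<close>; the bound \<open>\<delta>\<close> makes the diameter itself an
    admissible radius.\<close>
  obtain S where S: "S \<in> closed_balls" "x \<in> S" "diameter S < min e (min R \<delta>)"
      "ennreal t * zeta_b c \<alpha> S < \<mu> S"
    using small[of "min e (min R \<delta>)"] e R \<delta> by auto
  obtain y r where yr: "S = cball y r" "r > 0"
    using S(1) by (auto simp: closed_balls_def)
  have bS: "bounded S" using S(1) by (rule closed_balls_bounded)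
  have yS: "y \<in> S" using yr by simp
  show thesis
  \<comment> \<open>In the degenerate case \<open>x\<close> is the centre of \<open>S\<close>, so
    \<open>S\<close> is already a neighbourhood of \<open>x\<close>.\<close>
  proof (cases "diameter S = 0")
    case True
    have "dist x y \<le> 0"
      using diameter_bounded_bound[OF bS S(2) yS] True by simp
    then have "x \<in> ball y r" using yr by simp
    moreover have "ball y r \<subseteq> interior S"
      unfolding yr by (simp add: interior_maximal ball_subset_cball)
    ultimately show thesis
      using that[of S] S by auto
  next
    case False
    define d where "d = diameter S"
    have d: "d > 0" "d < e" "d < R" "d < \<delta>"
      using False S(3) closed_balls_diameter_nonneg[OF S(1)] by (auto simp: d_def)
    \<comment> \<open>The radius \<open>r\<close> may be far above \<open>\<delta>\<close>, where
      continuity is not known, while \<open>d\<close> is below it. Since \<open>S\<close> lies in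
      \<open>cball y d\<close>, the radius can be lowered to \<open>\<rho>\<close> without losing
      points.\<close>
    define \<rho> where "\<rho> = min r d"
    have \<rho>: "\<rho> > 0" "\<rho> < \<delta>" using d yr by (auto simp: \<rho>_def)
    have Sd: "S \<subseteq> cball y \<rho>"
    proof
      fix z assume z: "z \<in> S"
      then show "z \<in> cball y \<rho>"
        using diameter_bounded_bound[OF bS yS z] yr by (simp add: \<rho>_def d_def)
    qed
    have "y \<in> ball x R"
      using diameter_bounded_bound[OF bS S(2) yS] d by (simp add: d_def)
    then have "isCont (\<lambda>r. diameter (ball y r)) \<rho>"
      using \<rho> cont[of y] continuous_on_eq_continuous_at[OF open_greaterThanLessThan,
        of 0 \<delta> "\<lambda>r. diameter (ball y r)"] by simp
    then have "isCont (\<lambda>r. t * (c * diameter (ball y r) powr \<alpha>)) \<rho>"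
      using \<alpha> by (intro continuous_intros) (auto simp: diameter_ge_0)
    then have lim: "((\<lambda>r. ennreal (t * (c * diameter (ball y r) powr \<alpha>))) \<longlongrightarrow>
        ennreal (t * (c * diameter (ball y \<rho>) powr \<alpha>))) (at_right \<rho>)"
      unfolding isCont_def
      by (intro tendsto_ennrealI) (rule tendsto_mono[OF at_within_le_at])
    have dle: "diameter (ball y \<rho>) \<le> d"
    proof -
      have "ball y \<rho> \<subseteq> S" unfolding yr \<rho>_def by auto
      then show ?thesis unfolding d_def by (rule diameter_subset[OF _ bS])
    qed
    have "ennreal (t * (c * diameter (ball y \<rho>) powr \<alpha>)) \<le> ennreal t * zeta_b c \<alpha> S"
      using dle c t \<alpha> unfolding zeta_b_def d_def
      by (subst ennreal_mult[symmetric])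
        (auto intro!: ennreal_leI mult_left_mono powr_mono2 simp: diameter_ge_0)
    also have "\<dots> < \<mu> S" by (rule S(4))
    finally have ev1: "\<forall>\<^sub>F r in at_right \<rho>. ennreal (t * (c * diameter (ball y r) powr \<alpha>)) < \<mu> S"
      using lim order_tendstoD(2) by blast
    have "((\<lambda>r. diameter (ball y r)) \<longlongrightarrow> diameter (ball y \<rho>)) (at_right \<rho>)"
      using \<open>isCont (\<lambda>r. diameter (ball y r)) \<rho>\<close> unfolding isCont_def
      by (rule tendsto_mono[rotated]) (simp add: at_within_le_at)
    then have ev2: "\<forall>\<^sub>F r in at_right \<rho>. diameter (ball y r) < e"
      by (rule order_tendstoD(2)) (use dle d(2) in simp)
    have "\<forall>\<^sub>F r in at_right \<rho>. \<rho> < r"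
      by (simp add: eventually_at_filter)
    then have "\<forall>\<^sub>F r in at_right \<rho>. ennreal (t * (c * diameter (ball y r) powr \<alpha>)) < \<mu> S \<and>
        diameter (ball y r) < e \<and> \<rho> < r"
      using ev1 ev2 by eventually_elim auto
    then obtain r' where r': "ennreal (t * (c * diameter (ball y r') powr \<alpha>)) < \<mu> S"
        "diameter (ball y r') < e" "\<rho> < r'"
      using eventually_happens'[of "at_right \<rho>"] by (auto simp: trivial_limit_at_right_real)
    \<comment> \<open>Regularity controls open balls; a closed ball of radius strictly below
      \<open>r'\<close> fits inside \<open>ball y r'\<close>.\<close>
    define r2 where "r2 = (\<rho> + r') / 2"
    have r2: "\<rho> < r2" "r2 < r'" using r'(3) by (auto simp: r2_def)
    have sub: "cball y r2 \<subseteq> ball y r'" using r2 by auto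
    have dsub: "diameter (cball y r2) \<le> diameter (ball y r')"
      by (rule diameter_subset[OF sub]) simp
    show thesis
    proof (rule that[of "cball y r2"])
      show "cball y r2 \<in> closed_balls"
        using r2 \<rho> by (intro cball_in_closed_balls) simp
      have "x \<in> ball y r2"
        using Sd S(2) r2 by auto
      moreover have "ball y r2 \<subseteq> interior (cball y r2)"
        by (simp add: interior_maximal ball_subset_cball)
      ultimately show "x \<in> interior (cball y r2)" by blast
      show "diameter (cball y r2) < e"
        using dsub r'(2) by simp
      have "ennreal t * zeta_b c \<alpha> (cball y r2) \<le> ennreal (t * (c * diameter (ball y r') powr \<alpha>))"
        using dsub c t \<alpha> unfolding zeta_b_def
        by (subst ennreal_mult[symmetric])
          (auto intro!: ennreal_leI mult_left_mono powr_mono2 simp: diameter_ge_0)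
      also have "\<dots> < \<mu> S" by (rule r'(1))
      also have "\<mu> S \<le> \<mu> (cball y r2)"
      proof (rule measure_over_mono[OF m])
        show "S \<subseteq> cball y r2" using Sd r2 by auto
      qed
      finally show "ennreal t * zeta_b c \<alpha> (cball y r2) < \<mu> (cball y r2)" .
    qed
  qed
qed

text \<open>For \<open>t \<ge> 0\<close> the countable intersection of open sets \<open>W t\<close>
  lies between the sets where the density is \<open>> t\<close> and \<open>\<ge> t\<close>. The
  first inclusion is where \<open>exceeding_ball_neighbourhood\<close> is needed, since
  \<open>W t\<close> is made of interiors. Such a sandwich at all rational levels above
  \<open>a\<close> recovers the strict superlevel set of \<open>a\<close>.\<close>

lemma federer_density_borel:
  fixes \<mu> :: "'a::metric_space set \<Rightarrow> ennreal"
  assumes m: "measure_over \<mu>" and c: "c > 0" and \<alpha>: "\<alpha> > 0"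
    and reg: "diametrically_regular TYPE('a)"
  shows "federer_density c \<alpha> \<mu> \<in> borel_measurable borel"
proof (rule borel_measurableI_greater)
  let ?s = "federer_density c \<alpha> \<mu>"
  define W where "W t = (\<Inter>n. interior {x. \<exists>S\<in>closed_balls. x \<in> S \<and> diameter S < 1 / real (Suc n) \<and>
      ennreal t * zeta_b c \<alpha> S < \<mu> S})" for t
  have Wb: "W t \<in> sets borel" for t
    unfolding W_def by auto
  have up: "x \<in> W t" if gt: "ennreal t < ?s x" "t \<ge> 0" for t x
    unfolding W_def
  proof (rule INT_I)
    fix n :: nat
    obtain S where S: "S \<in> closed_balls" "x \<in> interior S" "diameter S < 1 / real (Suc n)"
        "ennreal t * zeta_b c \<alpha> S < \<mu> S"
    proof (rule exceeding_ball_neighbourhood[OF m c \<alpha> gt(2) reg, of x "1 / real (Suc n)"])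
      show "\<exists>S\<in>closed_balls. x \<in> S \<and> diameter S < e \<and> ennreal t * zeta_b c \<alpha> S < \<mu> S" if e: "e > 0" for e
        using gt(1) e by (rule federer_density_gtD) blast
    qed auto
    have "interior S \<subseteq> {x. \<exists>S\<in>closed_balls. x \<in> S \<and> diameter S < 1 / real (Suc n) \<and>
        ennreal t * zeta_b c \<alpha> S < \<mu> S}"
      using S interior_subset by blast
    then show "x \<in> interior {x. \<exists>S\<in>closed_balls. x \<in> S \<and> diameter S < 1 / real (Suc n) \<and>
        ennreal t * zeta_b c \<alpha> S < \<mu> S}"
      using S(2) by (meson interior_maximal open_interior subsetD)
  qed
  have down: "ennreal t \<le> ?s x" if x: "x \<in> W t" for t x
  proof (rule ccontr)
    assume "\<not> ?thesis"
    then have "?s x < ennreal t" by simp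
    then obtain \<epsilon> where \<epsilon>: "\<epsilon> > 0"
      "\<And>S. S \<in> closed_balls \<Longrightarrow> x \<in> S \<Longrightarrow> diameter S < \<epsilon> \<Longrightarrow> \<mu> S \<le> ennreal t * zeta_b c \<alpha> S"
      by (rule federer_density_lessD) blast
    obtain n where n: "1 / real (Suc n) < \<epsilon>"
      using \<epsilon>(1) by (rule nat_approx_posE)
    have "x \<in> {x. \<exists>S\<in>closed_balls. x \<in> S \<and> diameter S < 1 / real (Suc n) \<and>
        ennreal t * zeta_b c \<alpha> S < \<mu> S}"
      using x interior_subset unfolding W_def by blast
    then obtain S where "S \<in> closed_balls" "x \<in> S" "diameter S < 1 / real (Suc n)"
        "ennreal t * zeta_b c \<alpha> S < \<mu> S"
      by blast
    then show False
      using \<epsilon>(2)[of S] n by (simp add: not_le[symmetric])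
  qed
  fix a :: ennreal
  have "{x \<in> space borel. a < ?s x} = (\<Union>q\<in>{q :: rat. 0 \<le> q \<and> a < ennreal (of_rat q)}. W (of_rat q))"
  proof (intro equalityI subsetI)
    fix x assume "x \<in> {x \<in> space borel. a < ?s x}"
    then obtain q :: rat where q: "a < ennreal (of_rat q)" "ennreal (of_rat q) < ?s x"
      using ennreal_rat_dense[of a "?s x"] by auto
    then have "0 < (of_rat q :: real)"
      by (metis ennreal_less_zero_iff le_less_trans zero_le)
    then have "0 \<le> q" by simp
    then show "x \<in> (\<Union>q\<in>{q :: rat. 0 \<le> q \<and> a < ennreal (of_rat q)}. W (of_rat q))"
      using q up[OF q(2)] by auto
  next
    fix x assume "x \<in> (\<Union>q\<in>{q :: rat. 0 \<le> q \<and> a < ennreal (of_rat q)}. W (of_rat q))"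
    then show "x \<in> {x \<in> space borel. a < ?s x}"
      using down by (auto intro: less_le_trans)
  qed
  also have "\<dots> \<in> sets borel"
    using Wb by (intro sets.countable_UN') (auto intro: countable_subset[of _ UNIV])
  finally show "{x \<in> space borel. a < ?s x} \<in> sets borel" .
qed

section \<open>Comparison of \<open>\<mu>\<close> with the spherical measure under bounds on the
  density\<close>

lemma measure_le_density_less:
  fixes \<mu> :: "'a::metric_space set \<Rightarrow> ennreal"
  assumes m: "measure_over \<mu>" and b: "borel_regular \<mu>"
    and t: "t > 0" and less: "\<And>x. x \<in> E \<Longrightarrow> federer_density c \<alpha> \<mu> x < ennreal t"
  shows "\<mu> E \<le> ennreal t * spherical_measure c \<alpha> E"
proof -
  define F where "F n = {x\<in>E. \<forall>S\<in>closed_balls. x \<in> S \<longrightarrow> diameter S < 1 / real (Suc n) \<longrightarrow>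
      \<mu> S \<le> ennreal t * zeta_b c \<alpha> S}" for n
  have "F i \<subseteq> F j" if "i \<le> j" for i j
    using that frac_le[of 1 1 "real (Suc i)" "real (Suc j)"] by (fastforce simp: F_def)
  then have inc: "incseq F"
    by (simp add: incseq_def)
  have "E = (\<Union>n. F n)"
  proof (intro equalityI subsetI)
    fix x assume x: "x \<in> E"
    obtain \<epsilon> where \<epsilon>: "\<epsilon> > 0"
      "\<And>S. S \<in> closed_balls \<Longrightarrow> x \<in> S \<Longrightarrow> diameter S < \<epsilon> \<Longrightarrow> \<mu> S \<le> ennreal t * zeta_b c \<alpha> S"
      using less[OF x] by (rule federer_density_lessD) blast
    obtain n where n: "1 / real (Suc n) < \<epsilon>"
      using \<epsilon>(1) by (rule nat_approx_posE)
    then have "x \<in> F n"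
      using x \<epsilon>(2) by (auto simp: F_def)
    then show "x \<in> (\<Union>n. F n)" by blast
  qed (auto simp: F_def)
  then have "\<mu> E = (SUP n. \<mu> (F n))"
    using borel_regular_SUP[OF m b inc] by simp
  also have "\<dots> \<le> ennreal t * spherical_measure c \<alpha> E"
  proof (rule SUP_least)
    fix n
    \<comment> \<open>\<open>F n\<close> concerns diameters strictly below \<open>1 / Suc n\<close>,
      coverings concern diameters at most \<open>?\<delta>\<close>; passing to the next reciprocal
      reconciles the two.\<close>
    let ?\<delta> = "1 / real (Suc (Suc n))"
    have "ennreal (1 / t) * \<mu> (F n) \<le> spherical_pre c \<alpha> ?\<delta> (F n)"
    proof (rule spherical_pre_greatest)
      fix J :: "nat set" and B
      assume cb: "\<And>j. j \<in> J \<Longrightarrow> B j \<in> closed_balls" and diam: "\<And>j. j \<in> J \<Longrightarrow> diameter (B j) \<le> ?\<delta>"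
        and cov: "F n \<subseteq> (\<Union>j\<in>J. B j)"
      \<comment> \<open>Balls that miss \<open>F n\<close> are replaced by the empty set, because
        the bound on \<open>\<mu>\<close> is known only for balls containing a point of
        \<open>F n\<close>.\<close>
      let ?B = "\<lambda>j. if j \<in> J \<and> B j \<inter> F n \<noteq> {} then B j else {}"
      have "F n \<subseteq> (\<Union>j. ?B j)"
      proof
        fix x assume x: "x \<in> F n"
        then obtain j where "j \<in> J" "x \<in> B j" using cov by blast
        then have "x \<in> ?B j" using x by auto
        then show "x \<in> (\<Union>j. ?B j)" by blast
      qed
      then have "\<mu> (F n) \<le> \<mu> (\<Union>j. ?B j)"
        by (rule measure_over_mono[OF m])
      also have "\<dots> \<le> (\<Sum>j. \<mu> (?B j))"
        by (rule measure_over_UN[OF m])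
      also have "\<dots> \<le> (\<Sum>j. ennreal t * (if j \<in> J then zeta_b c \<alpha> (B j) else 0))"
      proof (intro suminf_le)
        fix j
        have "\<mu> (B j) \<le> ennreal t * zeta_b c \<alpha> (B j)" if j: "j \<in> J" "B j \<inter> F n \<noteq> {}"
        proof -
          obtain x where x: "x \<in> B j" "x \<in> F n" using j by blast
          have "diameter (B j) < 1 / real (Suc n)"
            using diam[OF j(1)] by (rule le_less_trans) (simp add: frac_less2)
          then show ?thesis
            using x cb[OF j(1)] by (auto simp: F_def)
        qed
        then show "\<mu> (?B j) \<le> ennreal t * (if j \<in> J then zeta_b c \<alpha> (B j) else 0)"
          using measure_over_empty[OF m] by auto
      qed auto
      also have "\<dots> = ennreal t * (\<Sum>j. if j \<in> J then zeta_b c \<alpha> (B j) else 0)"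
        by (rule ennreal_suminf_cmult)
      finally have "ennreal (1 / t) * \<mu> (F n) \<le>
          ennreal (1 / t) * (ennreal t * (\<Sum>j. if j \<in> J then zeta_b c \<alpha> (B j) else 0))"
        by (rule mult_left_mono) simp
      also have "\<dots> = (\<Sum>j. if j \<in> J then zeta_b c \<alpha> (B j) else 0)"
        using t by (simp add: mult.assoc[symmetric] ennreal_mult[symmetric])
      finally show "ennreal (1 / t) * \<mu> (F n) \<le> (\<Sum>j. if j \<in> J then zeta_b c \<alpha> (B j) else 0)" .
    qed
    also have "\<dots> \<le> spherical_measure c \<alpha> (F n)"
      by (rule spherical_pre_le_measure) simp
    also have "\<dots> \<le> spherical_measure c \<alpha> E"
      by (intro measure_over_mono[OF measure_over_spherical_measure]) (auto simp: F_def)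
    finally have "ennreal t * (ennreal (1 / t) * \<mu> (F n)) \<le> ennreal t * spherical_measure c \<alpha> E"
      by (rule mult_left_mono) simp
    then show "\<mu> (F n) \<le> ennreal t * spherical_measure c \<alpha> E"
      using t by (simp add: mult.assoc[symmetric] ennreal_mult[symmetric])
  qed
  finally show ?thesis .
qed

text \<open>Every finite part of the family has total measure at most that of \<open>V\<close>, so
  the measures are summable over \<open>\<G>\<close>, and a summable family of positive numbers is
  countable. This is how the Vitali family becomes a sequence.\<close>

lemma countable_disjoint_positive:
  assumes V: "V \<in> sets M" "emeasure M V < \<infinity>"
    and G: "disjoint \<G>" "\<And>S. S \<in> \<G> \<Longrightarrow> S \<in> sets M \<and> S \<subseteq> V \<and> 0 < emeasure M S"
  shows "countable \<G>"
proof -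
  have fin: "emeasure M S \<noteq> \<infinity>" if "S \<in> \<G>" for S
    using emeasure_mono[of S V M] G(2)[OF that] V by (auto simp: top_unique)
  have "sum (measure M) \<F> \<le> measure M V" if F: "\<F> \<subseteq> \<G>" "finite \<F>" for \<F>
  proof -
    have "disjoint_family_on (\<lambda>S. S) \<F>"
      unfolding disjoint_family_on_def using G(1) F(1) by (meson disjointD subsetD)
    then have "sum (measure M) \<F> = measure M (\<Union>S\<in>\<F>. S)"
      using F fin G(2) by (intro measure_finite_Union[symmetric]) auto
    also have "\<dots> \<le> measure M V"
      using F G V by (intro measure_mono_fmeasurable) (auto simp: fmeasurable_def)
    finally show ?thesis .
  qed
  then have "measure M summable_on \<G>"
    by (intro nonneg_bdd_above_summable_on bdd_aboveI[of _ "measure M V"]) auto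
  then have "countable {S\<in>\<G>. measure M S \<noteq> 0}"
    by (rule summable_countable_real)
  also have "{S\<in>\<G>. measure M S \<noteq> 0} = \<G>"
    using fin G(2) by (fastforce simp: measure_def enn2real_eq_0_iff)
  finally show ?thesis .
qed

text \<open>The balls of the disjoint family \<open>\<G>\<close> satisfy \<open>t * \<Sum>\<zeta> \<le> \<mu> V\<close>. By fineness it is enough to
  enlarge all but the first \<open>k\<close> of them in order to cover \<open>E\<close>; the cost of the enlargement is a
  tail of a convergent series and vanishes as \<open>k\<close> grows.\<close>

lemma density_greater_measure_le:
  fixes \<mu> :: "'a::metric_space set \<Rightarrow> ennreal"
  assumes m: "measure_over \<mu>" and b: "sets borel \<subseteq> caratheodory_sets \<mu>"
    and c: "c > 0" and \<alpha>: "\<alpha> > 0" and t: "t > 0"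
    and V: "open V" "\<mu> V < \<infinity>" "E \<subseteq> V"
    and gt: "\<And>x. x \<in> E \<Longrightarrow> ennreal t < federer_density c \<alpha> \<mu> x"
  shows "ennreal t * spherical_measure c \<alpha> E \<le> \<mu> V"
  unfolding spherical_measure_def SUP_mult_left_ennreal
proof (rule SUP_least)
  let ?N = "caratheodory_restriction \<mu>" and ?\<zeta> = "zeta_b c \<alpha> :: 'a set \<Rightarrow> ennreal"
  fix \<delta> :: real assume "\<delta> \<in> {0<..}"
  then have \<delta>: "\<delta> > 0" by simp
  have bor: "S \<in> sets ?N" if "S \<in> sets borel" for S
    using b that unfolding sets_caratheodory_restriction[OF m] by blast
  have N: "emeasure ?N S = \<mu> S" if "S \<in> sets ?N" for S
    using that unfolding sets_caratheodory_restriction[OF m] by (rule emeasure_caratheodory_restriction[OF m])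
  have VN: "V \<in> sets ?N" using V(1) bor by simp
  \<comment> \<open>The bound \<open>\<delta> / 6\<close> leaves room for the enlargement, which
    multiplies diameters by at most 6.\<close>
  define \<F> where "\<F> = {S\<in>closed_balls. S \<subseteq> V \<and> diameter S \<le> \<delta> / 6 \<and> ennreal t * ?\<zeta> S < \<mu> S}"
  have fine: "\<exists>S\<in>\<F>. x \<in> S \<and> S \<subseteq> U" if x: "x \<in> E" and U: "open U" "x \<in> U" for x U
  proof -
    have "open (V \<inter> U)" "x \<in> V \<inter> U" using x U V by auto
    then obtain r where r: "r > 0" "ball x r \<subseteq> V \<inter> U"
      by (rule openE)
    obtain S where S: "S \<in> closed_balls" "x \<in> S" "diameter S < min r (\<delta> / 6)"
        "ennreal t * zeta_b c \<alpha> S < \<mu> S"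
      by (rule federer_density_gtD[OF gt[OF x], of "min r (\<delta> / 6)"]) (use r(1) \<delta> in auto)
    have "S \<subseteq> V \<inter> U"
      using closed_balls_subset_ball[OF S(1,2), of r] S(3) r(2) by auto
    then have "S \<in> \<F>" "S \<subseteq> U"
      using S by (simp_all add: \<F>_def)
    then show ?thesis
      using S(2) by blast
  qed
  have ne: "{} \<notin> \<F>"
    using closed_balls_nonempty by (auto simp: \<F>_def)
  have diam: "0 \<le> diameter S \<and> diameter S \<le> \<delta> / 6" if "S \<in> \<F>" for S
    using that closed_balls_diameter_nonneg by (auto simp: \<F>_def)
  obtain \<G> where G: "\<G> \<subseteq> \<F>" "disjoint \<G>"
    and Vit: "\<And>S. S \<in> \<F> \<Longrightarrow> \<exists>T\<in>\<G>. S \<inter> T \<noteq> {} \<and> diameter S \<le> 2 * diameter T"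
    by (rule Vitali_disjoint_subfamily[of \<F> diameter "\<delta> / 6", OF diam ne]) (assumption | rule that)+
  have GB: "S \<in> closed_balls" "S \<subseteq> V" "diameter S \<le> \<delta> / 6" "ennreal t * ?\<zeta> S < \<mu> S" "S \<in> sets ?N"
    if "S \<in> \<G>" for S
    using that G(1) by (auto simp: \<F>_def intro!: bor borel_closed closed_balls_closed)
  have "countable \<G>"
  proof (rule countable_disjoint_positive[OF VN])
    show "emeasure ?N V < \<infinity>" using V N VN by simp
    show "S \<in> sets ?N \<and> S \<subseteq> V \<and> 0 < emeasure ?N S" if "S \<in> \<G>" for S
      using GB[OF that] N[of S] by (auto intro: le_less_trans[OF zero_le])
  qed (rule G(2))
  \<comment> \<open>Coverings in \<open>spherical_pre\<close> are indexed by sets of naturals, so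
    the countable family, finite or infinite, is transported to such a set \<open>J\<close>.\<close>
  then obtain f :: "'a set \<Rightarrow> nat" where f: "inj_on f \<G>"
    by (rule countableE)
  define J where "J = f ` \<G>"
  define S where "S = inv_into \<G> f"
  have bij: "bij_betw S J \<G>"
    unfolding S_def J_def using f by (intro bij_betw_inv_into) (simp add: bij_betw_def)
  have SG: "S j \<in> \<G>" if "j \<in> J" for j
    using bij that by (auto simp: bij_betw_def)
  define a where "a j = (if j \<in> J then ?\<zeta> (S j) else 0)" for j
  have ta: "ennreal t * (\<Sum>j. a j) \<le> \<mu> V"
  proof -
    let ?S = "\<lambda>j. if j \<in> J then S j else {}"
    have disj: "disjoint_family ?S"
      unfolding disjoint_family_on_def
    proof (intro ballI impI)
      fix i j :: nat assume "i \<noteq> j"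
      then have "S i \<noteq> S j" if "i \<in> J" "j \<in> J"
        using bij that by (auto simp: bij_betw_def inj_on_def)
      then show "?S i \<inter> ?S j = {}"
        using G(2) SG by (auto simp: disjoint_def)
    qed
    have "ennreal t * (\<Sum>j. a j) = (\<Sum>j. ennreal t * a j)"
      by (rule ennreal_suminf_cmult[symmetric])
    also have "\<dots> \<le> (\<Sum>j. emeasure ?N (?S j))"
      using GB[OF SG] N by (intro suminf_le) (auto simp: a_def less_imp_le)
    also have "\<dots> = emeasure ?N (\<Union>j. ?S j)"
      using GB(5)[OF SG] by (intro suminf_emeasure disj) auto
    also have "\<dots> \<le> emeasure ?N V"
      using GB(2)[OF SG] VN by (intro emeasure_mono) (auto split: if_splits)
    finally show ?thesis using N[OF VN] by simp
  qed
  have afin: "(\<Sum>j. a j) \<noteq> \<infinity>"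
    using ta t V(2) by (auto simp: ennreal_mult_top top_unique)
  have "\<forall>T\<in>closed_balls. \<exists>T'. T' \<in> closed_balls \<and> diameter T' \<le> 6 * diameter T \<and>
      (\<forall>S. bounded S \<longrightarrow> S \<inter> T \<noteq> {} \<longrightarrow> diameter S \<le> 2 * diameter T \<longrightarrow> S \<subseteq> T')" for T :: "'a set"
    by (intro ballI, erule closed_balls_enlarge) blast
  then obtain enl :: "'a set \<Rightarrow> 'a set" where enl: "\<And>T. T \<in> closed_balls \<Longrightarrow> enl T \<in> closed_balls"
      "\<And>T. T \<in> closed_balls \<Longrightarrow> diameter (enl T) \<le> 6 * diameter T"
      "\<And>S T. T \<in> closed_balls \<Longrightarrow> bounded S \<Longrightarrow> S \<inter> T \<noteq> {} \<Longrightarrow> diameter S \<le> 2 * diameter T \<Longrightarrow> S \<subseteq> enl T"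
    by metis
  define K where "K = ennreal (6 powr \<alpha>)"
  have bound: "spherical_pre c \<alpha> \<delta> E \<le> (\<Sum>j. a j) + K * (\<Sum>j. a (j + k))" for k
  proof -
    let ?B = "\<lambda>j. if j < k then S j else enl (S j)"
    let ?g = "\<lambda>j. if j < k then 0 else K * a j"
    have "spherical_pre c \<alpha> \<delta> E \<le> (\<Sum>j. if j \<in> J then ?\<zeta> (?B j) else 0)"
    proof (rule spherical_pre_le)
      fix j assume "j \<in> J"
      note S = GB[OF SG[OF this]]
      show "?B j \<in> closed_balls \<and> diameter (?B j) \<le> \<delta>"
        using S(1,3) enl(1)[OF S(1)] enl(2)[OF S(1)] \<delta> by auto
    next
      show "E \<subseteq> (\<Union>j\<in>J. ?B j)"
      proof
        fix x assume x: "x \<in> E"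
        define C where "C = (\<Union>j\<in>J \<inter> {..<k}. S j)"
        show "x \<in> (\<Union>j\<in>J. ?B j)"
        proof (cases "x \<in> C")
          case True
          then show ?thesis unfolding C_def by auto
        next
          case False
          \<comment> \<open>Since \<open>C\<close> is closed, \<open>x\<close> lies in a ball
            \<open>T\<close> of the fine family that avoids \<open>C\<close>. The Vitali partner of
            \<open>T\<close> meets \<open>T\<close>, so it is not among the first \<open>k\<close>
            balls, and its enlargement catches \<open>x\<close>.\<close>
          have "closed C"
            unfolding C_def using GB(1)[OF SG] by (intro closed_UN ballI closed_balls_closed) auto
          then obtain T where T: "T \<in> \<F>" "x \<in> T" "T \<subseteq> - C"
            using fine[OF x, of "- C"] False by auto
          obtain T' where T': "T' \<in> \<G>" "T \<inter> T' \<noteq> {}" "diameter T \<le> 2 * diameter T'"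
            using Vit[OF T(1)] by blast
          obtain j where j: "j \<in> J" "T' = S j"
            using bij T'(1) by (auto simp: bij_betw_def)
          have "\<not> j < k"
            using T(3) T'(2) j by (auto simp: C_def)
          moreover have "T \<subseteq> enl (S j)"
          proof (rule enl(3))
            show "bounded T" using T(1) by (simp add: \<F>_def closed_balls_bounded)
          qed (use T' j GB(1) in auto)
          ultimately show ?thesis
            using T(2) j(1) by auto
        qed
      qed
    qed
    also have "\<dots> \<le> (\<Sum>j. a j + ?g j)"
    proof (intro suminf_le)
      fix j
      show "(if j \<in> J then ?\<zeta> (?B j) else 0) \<le> a j + ?g j"
      proof (cases "j \<in> J \<and> \<not> j < k")
        case True
        have S: "S j \<in> closed_balls" using True GB SG by blast
        have "?\<zeta> (enl (S j)) \<le> K * ?\<zeta> (S j)"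
          unfolding K_def using c \<alpha> S enl(1,2)[OF S]
          by (intro zeta_b_scale closed_balls_diameter_nonneg) auto
        then show ?thesis
          using True by (auto simp: a_def intro: add_increasing)
      qed (auto simp: a_def)
    qed auto
    also have "\<dots> = (\<Sum>j. a j) + (\<Sum>j. ?g j)"
      by (rule suminf_add[symmetric]) auto
    also have "(\<Sum>j. ?g j) = (\<Sum>j. K * a (j + k))"
      by (subst suminf_offset[of _ k]) auto
    finally show ?thesis by simp
  qed
  have "(\<lambda>k. (\<Sum>j. a j) + K * (\<Sum>j. a (j + k))) \<longlonglongrightarrow> (\<Sum>j. a j) + K * 0"
    by (intro tendsto_add tendsto_const ennreal_tendsto_cmult ennreal_suminf_tail afin) (simp add: K_def)
  then have "spherical_pre c \<alpha> \<delta> E \<le> (\<Sum>j. a j)"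
    using bound by (intro Lim_bounded2[of _ "\<Sum>j. a j"]) auto
  then have "ennreal t * spherical_pre c \<alpha> \<delta> E \<le> ennreal t * (\<Sum>j. a j)"
    by (rule mult_left_mono) simp
  then show "ennreal t * spherical_pre c \<alpha> \<delta> E \<le> \<mu> V"
    using ta by (rule order_trans)
qed

lemma density_greater_le:
  fixes \<mu> :: "'a::metric_space set \<Rightarrow> ennreal"
  assumes m: "measure_over \<mu>" and b: "borel_regular \<mu>"
    and c: "c > 0" and \<alpha>: "\<alpha> > 0" and t: "t > 0"
    and U: "open U" "\<mu> U < \<infinity>" "E \<subseteq> U"
    and gt: "\<And>x. x \<in> E \<Longrightarrow> ennreal t < federer_density c \<alpha> \<mu> x"
  shows "ennreal t * spherical_measure c \<alpha> E \<le> \<mu> E"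
proof (rule ennreal_le_epsilon)
  fix e :: real assume "0 < e"
  then obtain V where V: "open V" "E \<subseteq> V" "V \<subseteq> U" "\<mu> V \<le> \<mu> E + ennreal e"
    by (rule borel_regular_outer_open[OF m b U])
  have "\<mu> V < \<infinity>"
    using measure_over_mono[OF m V(3)] U(2) by (rule le_less_trans)
  then have "ennreal t * spherical_measure c \<alpha> E \<le> \<mu> V"
    using b by (intro density_greater_measure_le[OF m _ c \<alpha> t V(1) _ V(2) gt]) (auto simp: borel_regular_def)
  then show "ennreal t * spherical_measure c \<alpha> E \<le> \<mu> E + ennreal e"
    using V(4) by (rule order_trans)
qed

section \<open>Integration of the density\<close>

text \<open>An error proportional to \<open>M\<close> on each slice adds up to an error of the same
  form. \<open>X\<close> and \<open>Y\<close> stay general because the bound is used in both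
  directions between \<open>\<mu>\<close> and the indefinite integral.\<close>

lemma emeasure_slices_le:
  assumes "\<And>k::nat. E k \<in> sets M \<and> E k \<in> sets X \<and> E k \<in> sets Y" "disjoint_family E"
    and "\<And>k. emeasure X (E k) \<le> emeasure Y (E k) + e * emeasure M (E k)"
  shows "emeasure X (\<Union>k. E k) \<le> emeasure Y (\<Union>k. E k) + e * emeasure M (\<Union>k. E k)"
proof -
  have "emeasure X (\<Union>k. E k) = (\<Sum>k. emeasure X (E k))"
    using assms by (intro suminf_emeasure[symmetric]) auto
  also have "\<dots> \<le> (\<Sum>k. emeasure Y (E k) + e * emeasure M (E k))"
    using assms(3) by (intro suminf_le) auto
  also have "\<dots> = (\<Sum>k. emeasure Y (E k)) + e * (\<Sum>k. emeasure M (E k))"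
    by (subst suminf_add[symmetric]) auto
  also have "(\<Sum>k. emeasure Y (E k)) = emeasure Y (\<Union>k. E k)"
    using assms by (intro suminf_emeasure) auto
  also have "(\<Sum>k. emeasure M (E k)) = emeasure M (\<Union>k. E k)"
    using assms by (intro suminf_emeasure) auto
  finally show ?thesis .
qed

lemma ennreal_le_small_multiple:
  fixes x y z :: ennreal
  assumes z: "z < \<infinity>" and le: "\<And>e. e > 0 \<Longrightarrow> x \<le> y + ennreal e * z"
  shows "x \<le> y"
proof (rule ennreal_le_epsilon)
  fix e :: real assume e: "e > 0"
  obtain r where r: "z = ennreal r" "r \<ge> 0"
    using z by (cases z) auto
  \<comment> \<open>The denominator \<open>r + 1\<close> is positive even if \<open>z\<close> is
    0.\<close>
  have "x \<le> y + ennreal (e / (r + 1)) * z"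
    using e r by (intro le) simp
  also have "ennreal (e / (r + 1)) * z \<le> ennreal e"
    using e r by (simp add: r(1) field_simps flip: ennreal_mult)
  finally show "x \<le> y + ennreal e"
    by (simp add: add_left_mono)
qed

text \<open>The two comparisons enter as the hypotheses \<open>le\<close> and \<open>ge\<close>, for
  measures whose measurable sets may differ. Once the points with \<open>s = \<infinity>\<close> are
  discarded, \<open>N\<close> and the indefinite integral are caught on each slice between nearby
  multiples of \<open>M\<close>. They therefore differ by at most \<open>e\<close> times the measure
  of \<open>P\<close>, which is finite, and \<open>e\<close> is arbitrary.\<close>

lemma emeasure_eq_nn_integral_ratio:
  fixes M N :: "'a measure" and s :: "'a \<Rightarrow> ennreal"
  assumes s [measurable]: "s \<in> borel_measurable M"
    and P: "P \<in> sets M" "emeasure M P < \<infinity>" "emeasure N P < \<infinity>"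
    and sub: "\<And>E. E \<in> sets M \<Longrightarrow> E \<subseteq> P \<Longrightarrow> E \<in> sets N"
    and le: "\<And>E t. E \<in> sets M \<Longrightarrow> E \<subseteq> P \<Longrightarrow> t > 0 \<Longrightarrow> (\<And>x. x \<in> E \<Longrightarrow> s x < ennreal t) \<Longrightarrow>
      emeasure N E \<le> ennreal t * emeasure M E"
    and ge: "\<And>E t. E \<in> sets M \<Longrightarrow> E \<subseteq> P \<Longrightarrow> t > 0 \<Longrightarrow> (\<And>x. x \<in> E \<Longrightarrow> ennreal t < s x) \<Longrightarrow>
      ennreal t * emeasure M E \<le> emeasure N E"
    and ac: "\<And>E. E \<in> sets M \<Longrightarrow> E \<subseteq> P \<Longrightarrow> emeasure M E = 0 \<Longrightarrow> emeasure N E = 0"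
  shows "emeasure N P = emeasure (density M s) P"
proof -
  note P(1) [measurable]
  let ?D = "density M s"
  define I where "I = {x\<in>P. s x = \<infinity>}"
  have "I = P \<inter> {x\<in>space M. s x = \<infinity>}"
    using sets.sets_into_space[OF P(1)] by (auto simp: I_def)
  then have I [measurable]: "I \<in> sets M" by simp
  have IP: "I \<subseteq> P" by (auto simp: I_def)
  have PN: "P \<in> sets N" by (rule sub[OF P(1)]) simp
  have MI: "emeasure M I = 0"
  proof -
    have "emeasure M I \<le> 0 + ennreal e * emeasure N P" if e: "e > 0" for e
    proof -
      \<comment> \<open>On \<open>I\<close> every finite level is exceeded; the level
        \<open>1 / e\<close> gives a bound on the measure of \<open>I\<close> that vanishes with
        \<open>e\<close>.\<close>
      have "ennreal (1 / e) * emeasure M I \<le> emeasure N I"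
        using e IP by (intro ge I) (auto simp: I_def)
      also have "\<dots> \<le> emeasure N P"
        by (rule emeasure_mono[OF IP PN])
      finally have "ennreal e * (ennreal (1 / e) * emeasure M I) \<le> ennreal e * emeasure N P"
        by (rule mult_left_mono) simp
      then show ?thesis
        using e by (simp add: mult.assoc[symmetric] ennreal_mult[symmetric])
    qed
    then have "emeasure M I \<le> 0"
      by (rule ennreal_le_small_multiple[OF P(3)])
    then show ?thesis by simp
  qed
  have NI: "emeasure N I = 0"
    by (rule ac[OF I IP MI])
  have DI: "emeasure ?D I = 0"
    using MI by (simp add: emeasure_density nn_integral_null_set null_sets_def)
  have main: "emeasure N (P - I) \<le> emeasure ?D (P - I) + ennreal e * emeasure M P \<and>
      emeasure ?D (P - I) \<le> emeasure N (P - I) + ennreal e * emeasure M P" if e: "e > 0" for e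
  proof -
    \<comment> \<open>On slice \<open>k\<close> the lower factor will be
      \<open>(k - 1) * \<epsilon>\<close> and the upper one \<open>(k + 1) * \<epsilon>\<close>. The
      gap is at most two steps, hence the half.\<close>
    define \<epsilon> where "\<epsilon> = e / 2"
    have \<epsilon>: "\<epsilon> > 0" "e = \<epsilon> + \<epsilon>" using e by (auto simp: \<epsilon>_def)
    define E where "E k = {x\<in>P. ennreal (real k * \<epsilon>) \<le> s x \<and> s x < ennreal (real (Suc k) * \<epsilon>)}" for k
    have "E k = P \<inter> {x\<in>space M. ennreal (real k * \<epsilon>) \<le> s x \<and> s x < ennreal (real (Suc k) * \<epsilon>)}" for k
      using sets.sets_into_space[OF P(1)] by (auto simp: E_def)
    then have EM: "E k \<in> sets M" for k by simp
    have EP: "E k \<subseteq> P" for k by (auto simp: E_def)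
    \<comment> \<open>A point of \<open>P\<close> with finite density lies in exactly one slice, the
      one indexed by this floor; disjointness and the union of the slices both follow.\<close>
    have floor: "x \<in> E k \<longleftrightarrow> x \<in> P - I \<and> nat \<lfloor>enn2real (s x) / \<epsilon>\<rfloor> = k" for x k
    proof (cases "s x")
      case (real r)
      then have "x \<in> E k \<longleftrightarrow> x \<in> P - I \<and> real k * \<epsilon> \<le> r \<and> r < real (Suc k) * \<epsilon>"
        using \<epsilon> by (auto simp: E_def I_def ennreal_less_iff)
      also have "real k * \<epsilon> \<le> r \<and> r < real (Suc k) * \<epsilon> \<longleftrightarrow> real k \<le> r / \<epsilon> \<and> r / \<epsilon> < real k + 1"
        using \<epsilon> by (simp add: field_simps)
      also have "\<dots> \<longleftrightarrow> \<lfloor>r / \<epsilon>\<rfloor> = int k"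
        by (auto simp: floor_eq_iff)
      also have "\<dots> \<longleftrightarrow> nat \<lfloor>r / \<epsilon>\<rfloor> = k"
        using real \<epsilon> by auto
      finally show ?thesis using real by simp
    next
      case top
      then show ?thesis by (auto simp: E_def I_def)
    qed
    have disj: "disjoint_family E"
      by (auto simp: disjoint_family_on_def floor)
    have UE: "(\<Union>k. E k) = P - I"
      by (auto simp: floor)
    have D_lower: "ennreal (real k * \<epsilon>) * emeasure M (E k) \<le> emeasure ?D (E k)" for k
    proof -
      have "(\<integral>\<^sup>+x. ennreal (real k * \<epsilon>) * indicator (E k) x \<partial>M) \<le> (\<integral>\<^sup>+x. s x * indicator (E k) x \<partial>M)"
        by (intro nn_integral_mono) (auto simp: E_def indicator_def)
      then show ?thesis
        using EM by (simp add: emeasure_density nn_integral_cmult_indicator)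
    qed
    have D_upper: "emeasure ?D (E k) \<le> ennreal (real (Suc k) * \<epsilon>) * emeasure M (E k)" for k
    proof -
      have "(\<integral>\<^sup>+x. s x * indicator (E k) x \<partial>M) \<le> (\<integral>\<^sup>+x. ennreal (real (Suc k) * \<epsilon>) * indicator (E k) x \<partial>M)"
        by (intro nn_integral_mono) (auto simp: E_def indicator_def less_imp_le)
      then show ?thesis
        using EM by (simp add: emeasure_density nn_integral_cmult_indicator)
    qed
    have N_upper: "emeasure N (E k) \<le> ennreal (real (Suc k) * \<epsilon>) * emeasure M (E k)" for k
      using \<epsilon> by (intro le EM EP) (auto simp: E_def)
    \<comment> \<open>\<open>ge\<close> needs a strict inequality, hence \<open>k - 1\<close> instead of \<open>k\<close>\<close>
    have N_lower: "ennreal (real (k - 1) * \<epsilon>) * emeasure M (E k) \<le> emeasure N (E k)" for k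
    proof (cases "k \<le> 1")
      case False
      show ?thesis
      proof (rule ge[OF EM EP])
        show "real (k - 1) * \<epsilon> > 0" using False \<epsilon> by simp
        fix x assume "x \<in> E k"
        then have "ennreal (real k * \<epsilon>) \<le> s x" by (simp add: E_def)
        moreover have "ennreal (real (k - 1) * \<epsilon>) < ennreal (real k * \<epsilon>)"
          using False \<epsilon> by (intro ennreal_lessI) auto
        ultimately show "ennreal (real (k - 1) * \<epsilon>) < s x" by (rule less_le_trans[rotated])
      qed
    qed auto
    \<comment> \<open>For \<open>k = 0\<close> truncated subtraction gives \<open>k - 1 = 0\<close>,
      and the gap is a single step.\<close>
    have step: "ennreal (real (Suc k) * \<epsilon>) * z \<le> ennreal (real (k - 1) * \<epsilon>) * z + ennreal e * z" for k z
    proof -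
      have "real (Suc k) * \<epsilon> \<le> real (k - 1) * \<epsilon> + e"
      proof (cases k)
        case (Suc j)
        then show ?thesis using \<epsilon> by (simp add: algebra_simps)
      qed (use \<epsilon> in simp)
      then have "ennreal (real (Suc k) * \<epsilon>) \<le> ennreal (real (k - 1) * \<epsilon> + e)"
        by (rule ennreal_leI)
      also have "\<dots> = ennreal (real (k - 1) * \<epsilon>) + ennreal e"
        using \<epsilon>(1) e by (intro ennreal_plus) auto
      finally show ?thesis
        by (metis distrib_right mult_right_mono zero_le)
    qed
    have "emeasure N (E k) \<le> emeasure ?D (E k) + ennreal e * emeasure M (E k)" for k
    proof -
      have "ennreal (real (k - 1) * \<epsilon>) * emeasure M (E k) \<le> ennreal (real k * \<epsilon>) * emeasure M (E k)"
        using \<epsilon> by (intro mult_right_mono ennreal_leI) auto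
      then show ?thesis
        using N_upper[of k] step[of k "emeasure M (E k)"] D_lower[of k]
        by (meson add_right_mono order_trans)
    qed
    then have 1: "emeasure N (\<Union>k. E k) \<le> emeasure ?D (\<Union>k. E k) + ennreal e * emeasure M (\<Union>k. E k)"
      using EM sub[OF EM EP] disj by (intro emeasure_slices_le) auto
    have "emeasure ?D (E k) \<le> emeasure N (E k) + ennreal e * emeasure M (E k)" for k
      using D_upper[of k] step[of k "emeasure M (E k)"] N_lower[of k]
      by (meson add_right_mono order_trans)
    then have 2: "emeasure ?D (\<Union>k. E k) \<le> emeasure N (\<Union>k. E k) + ennreal e * emeasure M (\<Union>k. E k)"
      using EM sub[OF EM EP] disj by (intro emeasure_slices_le) auto
    have "ennreal e * emeasure M (\<Union>k. E k) \<le> ennreal e * emeasure M P"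
      using P(1) EP by (intro mult_left_mono emeasure_mono) auto
    then show ?thesis
      using 1 2 unfolding UE by (meson add_left_mono order_trans)
  qed
  have eq: "emeasure N (P - I) = emeasure ?D (P - I)"
  proof (rule antisym)
    show "emeasure N (P - I) \<le> emeasure ?D (P - I)"
      by (rule ennreal_le_small_multiple[OF P(2) conjunct1[OF main]])
    show "emeasure ?D (P - I) \<le> emeasure N (P - I)"
      by (rule ennreal_le_small_multiple[OF P(2) conjunct2[OF main]])
  qed
  have "I \<in> sets N" by (rule sub[OF I IP])
  then have "emeasure N P = emeasure N (P - I)"
    using NI PN by (intro emeasure_Diff_null_set[symmetric]) (auto simp: null_sets_def)
  also note eq
  also have "emeasure ?D (P - I) = emeasure ?D P"
    using DI by (intro emeasure_Diff_null_set) (auto simp: null_sets_def)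
  finally show ?thesis .
qed

section \<open>Transfer of measurability from \<psi> to \<mu>, and assembly over countably many
  pieces\<close>

lemma borel_regular_kernel:
  assumes m: "measure_over \<psi>" and b: "borel_regular \<psi>"
    and B: "B \<in> caratheodory_sets \<psi>" "\<psi> B < \<infinity>"
  obtains F where "F \<in> sets borel" "F \<subseteq> B" "\<psi> (B - F) = 0"
proof -
  obtain H where H: "H \<in> sets borel" "B \<subseteq> H" "\<psi> H = \<psi> B"
    using b unfolding borel_regular_def by blast
  have "\<psi> (H \<inter> B) + \<psi> (H - B) = \<psi> H"
    using B(1) unfolding caratheodory_sets_iff by blast
  moreover have "H \<inter> B = B" using H(2) by blast
  ultimately have "\<psi> B + \<psi> (H - B) = \<psi> B + 0"
    using H(3) by simp
  \<comment> \<open>Finiteness of \<open>\<psi> B\<close> permits the cancellation. A Borel null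
    hull \<open>G\<close> of the excess \<open>H - B\<close> is then removed from \<open>H\<close>,
    which leaves a Borel subset of \<open>B\<close>.\<close>
  then have "\<psi> (H - B) = 0"
    using B(2) by (simp only: ennreal_add_left_cancel) auto
  then obtain G where G: "G \<in> sets borel" "H - B \<subseteq> G" "\<psi> G = 0"
    using b unfolding borel_regular_def by metis
  have "\<psi> (B - (H - G)) \<le> \<psi> G"
    using H(2) by (intro measure_over_mono[OF m]) blast
  then show thesis
    using that[of "H - G"] H G by auto
qed

lemma countable_family_sequence:
  assumes "countable \<C>" "A \<subseteq> \<Union>\<C>" "\<And>E. E \<in> \<C> \<Longrightarrow> Q E" "Q {}"
  obtains e :: "nat \<Rightarrow> 'a set" where "A \<subseteq> (\<Union>n. e n)" "\<And>n. Q (e n)"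
proof -
  define e where "e = from_nat_into (insert {} \<C>)"
  have r: "range e = insert {} \<C>"
    unfolding e_def using assms(1) by (intro range_from_nat_into) auto
  show thesis
  proof (rule that[of e])
    show "A \<subseteq> (\<Union>n. e n)" using assms(2) r by auto
    show "Q (e n)" for n
      using assms(3,4) r by (metis insertE rangeI)
  qed
qed

theorem theorem5p8:
  fixes \<mu> :: "'a::metric_space set \<Rightarrow> ennreal"
    and c \<alpha> :: real
    and A :: "'a set"
  assumes "measure_over \<mu>"
    and "\<alpha> > 0"
    and "c > 0"
    and "diametrically_regular TYPE('a)"
    and "borel_regular \<mu>"
    and "covers_finely (nondegenerate_family closed_balls \<mu> (zeta_b c \<alpha>)) A"
    and "A \<in> caratheodory_sets (spherical_measure c \<alpha>)"
    and "sigma_finite_wrt (spherical_measure c \<alpha>) A"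
    and "\<exists>\<U>. countable \<U> \<and> A \<subseteq> \<Union>\<U> \<and> (\<forall>U\<in>\<U>. open U \<and> \<mu> U < \<infinity>)"
    and "abs_continuous_on A \<mu> (spherical_measure c \<alpha>)"
  shows "federer_density c \<alpha> \<mu> \<in>
           borel_measurable
             (restrict_space (caratheodory_restriction (spherical_measure c \<alpha>)) A) \<and>
         (\<forall>B. B \<subseteq> A \<and> B \<in> caratheodory_sets (spherical_measure c \<alpha>) \<longrightarrow>
            B \<in> caratheodory_sets \<mu> \<and>
            \<mu> B = (\<integral>\<^sup>+x\<in>B. federer_density c \<alpha> \<mu> x
                      \<partial>caratheodory_restriction (spherical_measure c \<alpha>)))"
proof -
  define \<psi> :: "'a set \<Rightarrow> ennreal" where "\<psi> = spherical_measure c \<alpha>"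
  define M where "M = caratheodory_restriction \<psi>"
  define N where "N = caratheodory_restriction \<mu>"
  define s where "s = federer_density c \<alpha> \<mu>"
  note m = assms(1) and \<alpha> = assms(2) and c = assms(3) and reg = assms(4) and b = assms(5)
  note AM = assms(7)[folded \<psi>_def]
  have m': "measure_over \<psi>"
    unfolding \<psi>_def by (rule measure_over_spherical_measure)
  have b': "borel_regular \<psi>"
    unfolding \<psi>_def by (rule borel_regular_spherical_measure)
  have setsM: "sets M = caratheodory_sets \<psi>" and setsN: "sets N = caratheodory_sets \<mu>"
    unfolding M_def N_def using sets_caratheodory_restriction m m' by blast+
  have M: "emeasure M E = \<psi> E" if "E \<in> sets M" for E
    using that unfolding setsM unfolding M_def by (rule emeasure_caratheodory_restriction[OF m'])
  have N: "emeasure N E = \<mu> E" if "E \<in> sets N" for E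
    using that unfolding setsN unfolding N_def by (rule emeasure_caratheodory_restriction[OF m])
  have borM: "sets borel \<subseteq> sets M" and borN: "sets borel \<subseteq> sets N"
    using b b' by (auto simp only: setsM setsN borel_regular_def)
  have ac: "\<mu> E = 0" if "E \<subseteq> A" "\<psi> E = 0" for E
    using assms(10) that unfolding abs_continuous_on_def \<psi>_def by blast
  have s: "s \<in> borel_measurable M"
  proof (rule measurableI)
    fix Y :: "ennreal set" assume "Y \<in> sets borel"
    then have "s -` Y \<inter> space borel \<in> sets borel"
      unfolding s_def using federer_density_borel[OF m c \<alpha> reg] by (rule measurable_sets[rotated])
    then show "s -` Y \<inter> space M \<in> sets M"
      using borM by (auto simp: M_def space_caratheodory_restriction)
  qed simp
  obtain \<C> where C: "countable \<C>" "A \<subseteq> \<Union>\<C>" "\<And>E. E \<in> \<C> \<Longrightarrow> \<psi> E < \<infinity>"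
    using assms(8) unfolding sigma_finite_wrt_def \<psi>_def by blast
  obtain e where e: "A \<subseteq> (\<Union>n. e n)" "\<And>n::nat. \<psi> (e n) < \<infinity>"
    using countable_family_sequence[of \<C> A "\<lambda>E. \<psi> E < \<infinity>"] C measure_over_empty[OF m'] by auto
  \<comment> \<open>The sets \<open>e n\<close> are arbitrary; their Borel hulls have the same
    finite measure and make the pieces below measurable.\<close>
  have "\<exists>H. H \<in> sets borel \<and> e n \<subseteq> H \<and> \<psi> H = \<psi> (e n)" for n
    using b' unfolding borel_regular_def by blast
  then obtain H where H: "\<And>n. H n \<in> sets borel" "\<And>n. e n \<subseteq> H n" "\<And>n. \<psi> (H n) = \<psi> (e n)"
    by metis
  obtain \<U> where "countable \<U>" "A \<subseteq> \<Union>\<U>" "\<And>U. U \<in> \<U> \<Longrightarrow> open U \<and> \<mu> U < \<infinity>"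
    using assms(9) by blast
  then obtain u where u: "A \<subseteq> (\<Union>n. u n)" "\<And>n::nat. open (u n) \<and> \<mu> (u n) < \<infinity>"
    using countable_family_sequence[of \<U> A "\<lambda>U. open U \<and> \<mu> U < \<infinity>"] measure_over_empty[OF m] by auto
  \<comment> \<open>Each pair of indices gives a piece of \<open>A\<close> that has finite
    \<psi>-measure and lies in an open set of finite \<mu>-measure, as the lower comparison
    requires.\<close>
  define Z where "Z k = A \<inter> H (fst (prod_decode k)) \<inter> u (snd (prod_decode k))" for k
  have Z: "Z k \<in> sets M" for k
    unfolding Z_def using H(1) u(2) borM AM setsM by (intro sets.Int) auto
  have ZA: "(\<Union>k. Z k) = A"
  proof (intro equalityI subsetI)
    fix x assume x: "x \<in> A"
    then obtain i j where "x \<in> H i" "x \<in> u j"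
      using e(1) u(1) H(2) by blast
    then have "x \<in> Z (prod_encode (i, j))"
      using x by (simp add: Z_def)
    then show "x \<in> (\<Union>k. Z k)" by blast
  qed (auto simp: Z_def)
  define P where "P = disjointed Z"
  have P: "P k \<in> sets M" for k
    using sets.range_disjointed_sets[of Z M] Z by (auto simp: P_def)
  have PZ: "P k \<subseteq> Z k" for k
    unfolding P_def by (rule disjointed_subset)
  have disj: "disjoint_family P"
    unfolding P_def by (rule disjoint_family_disjointed)
  have PA: "(\<Union>k. P k) = A"
    unfolding P_def UN_disjointed_eq by (rule ZA)
  have small: "\<psi> E < \<infinity>" "E \<subseteq> A" "E \<subseteq> u (snd (prod_decode k))" if E: "E \<subseteq> P k" for E k
  proof -
    have "E \<subseteq> H (fst (prod_decode k))"
      using E PZ[of k] by (auto simp: Z_def)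
    then have "\<psi> E \<le> \<psi> (e (fst (prod_decode k)))"
      using measure_over_mono[OF m'] H(3) by metis
    then show "\<psi> E < \<infinity>"
      using e(2) by (rule le_less_trans)
    show "E \<subseteq> A" "E \<subseteq> u (snd (prod_decode k))"
      using E PZ[of k] by (auto simp: Z_def)
  qed
  \<comment> \<open>\<open>E\<close> differs from a Borel set by a \<psi>-null subset of
    \<open>A\<close>. Absolute continuity makes the difference \<mu>-null, and \<mu>-null sets
    satisfy Caratheodory's condition.\<close>
  have piece: "E \<in> sets N" if E: "E \<in> sets M" "E \<subseteq> P k" for E k
  proof -
    obtain F where F: "F \<in> sets borel" "F \<subseteq> E" "\<psi> (E - F) = 0"
      using borel_regular_kernel[OF m' b', of E] E(1) small(1)[OF E(2)] setsM by blast
    have "\<mu> (E - F) = 0"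
      using F small(2)[OF E(2)] by (intro ac) auto
    then have "E - F \<in> sets N"
      unfolding setsN by (rule null_caratheodory_sets[OF m])
    then have "F \<union> (E - F) \<in> sets N"
      using F(1) borN by (intro sets.Un) auto
    also have "F \<union> (E - F) = E"
      using F(2) by blast
    finally show ?thesis .
  qed
  have local: "emeasure N E = emeasure (density M s) E" if E: "E \<in> sets M" "E \<subseteq> P k" for E k
  proof (rule emeasure_eq_nn_integral_ratio[OF s E(1)])
    note U = u(2)[of "snd (prod_decode k)"]
    have EN: "E \<in> sets N" by (rule piece[OF E])
    show "emeasure M E < \<infinity>"
      using small(1)[OF E(2)] M[OF E(1)] by simp
    show "emeasure N E < \<infinity>"
      using measure_over_mono[OF m small(3)[OF E(2)]] U N[OF EN] by (auto intro: le_less_trans)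
    fix F assume F: "F \<in> sets M" "F \<subseteq> E"
    then have FP: "F \<subseteq> P k" using E(2) by blast
    show FN: "F \<in> sets N" by (rule piece[OF F(1) FP])
    show "emeasure N F = 0" if "emeasure M F = 0"
      using that ac[OF small(2)[OF FP]] M[OF F(1)] N[OF FN] by simp
    fix t :: real assume t: "t > 0"
    show "emeasure N F \<le> ennreal t * emeasure M F" if "\<And>x. x \<in> F \<Longrightarrow> s x < ennreal t"
      unfolding M[OF F(1)] N[OF FN] \<psi>_def
      using that by (intro measure_le_density_less[OF m b t]) (simp add: s_def)
    show "ennreal t * emeasure M F \<le> emeasure N F" if "\<And>x. x \<in> F \<Longrightarrow> ennreal t < s x"
      unfolding M[OF F(1)] N[OF FN] \<psi>_def
      using that U small(3)[OF FP]
      by (intro density_greater_le[OF m b c \<alpha> t, of "u (snd (prod_decode k))"]) (simp_all add: s_def)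
  qed
  have "B \<in> caratheodory_sets \<mu> \<and> \<mu> B = (\<integral>\<^sup>+x\<in>B. s x \<partial>M)"
    if B: "B \<subseteq> A" "B \<in> caratheodory_sets \<psi>" for B
  proof -
    have BM: "B \<in> sets M" using B(2) setsM by blast
    have Bk: "B \<inter> P k \<in> sets M" for k using BM P by blast
    have BkN: "B \<inter> P k \<in> sets N" for k by (rule piece[OF Bk Int_lower2])
    have BU: "(\<Union>k. B \<inter> P k) = B" using B(1) PA by blast
    have d: "disjoint_family (\<lambda>k. B \<inter> P k)"
      using disj by (auto simp: disjoint_family_on_def)
    have BN: "B \<in> sets N"
      using BkN BU by (metis sets.countable_UN image_subsetI)
    have "\<mu> B = emeasure N (\<Union>k. B \<inter> P k)"
      using N[OF BN] BU by simp
    also have "\<dots> = (\<Sum>k. emeasure N (B \<inter> P k))"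
      using BkN d by (intro suminf_emeasure[symmetric]) auto
    also have "\<dots> = (\<Sum>k. emeasure (density M s) (B \<inter> P k))"
      using local[OF Bk Int_lower2] by simp
    also have "\<dots> = emeasure (density M s) (\<Union>k. B \<inter> P k)"
      using Bk d by (intro suminf_emeasure) auto
    also have "\<dots> = (\<integral>\<^sup>+x\<in>B. s x \<partial>M)"
      unfolding BU by (rule emeasure_density[OF s BM])
    finally show ?thesis
      using BN setsN by blast
  qed
  moreover have "s \<in> borel_measurable (restrict_space M A)"
    using s by (rule measurable_restrict_space1)
  ultimately show ?thesis
    unfolding s_def M_def \<psi>_def by blast
qed

end
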